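(* Let $\mathcal{E}$ be a qubit channel and let $\hat{\mathcal{E}}$ be its $4\times4$ matrix representation in the Pauli basis. If $\det\hat{\mathcal{E}}<0$, then $\mathcal{E}$ is entanglement-breaking. That is, all qubit channels which are not infinitesimal divisible in PTP are entanglement-breaking.
   Context: A qubit channel is a linear, completely positive, trace-preserving map on $\mathbb{C}^{2\times 2}$. The matrix $\hat{\mathcal{E}}$ has entries $\hat{\mathcal{E}}_{ij}=\mathrm{tr}\,[A_i\,\mathcal{E}[A_j]]$, where $\{A_i\}=\frac{1}{\sqrt2}\{\mathbb{1},\sigma_x,\sigma_y,\sigma_z\}$. A channel $\mathcal{E}$ is entanglement-breaking if for every positive integer $k$ and every density matrix $\sigma$ on $\mathbb{C}^k\otimes\mathbb{C}^2$, the state $(\mathrm{id}_k\otimes\mathcal{E})[\sigma]$ is separable (a convex combination of product states). PTP denotes the set of linear, positive (not necessarily completely positive), trace-preserving maps. Let $\mathcal{L}_{\mathrm P}$ be the set of channels $\mathcal{E}$ (completely positive, trace-preserving) such that for every $\epsilon>0$ there exist finitely many PTP maps $\mathcal{E}_i$ with $|\mathcal{E}_i-\mathrm{id}|<\epsilon$ and $\mathcal{E}=\prod_i\mathcal{E}_i$. A channel is infinitesimal divisible in PTP if it belongs to the closure of $\mathcal{L}_{\mathrm P}$. It is known (Wolf and Cirac) that a qubit channel is infinitesimal divisible in PTP if and only if its determinant is non-negative. *)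

theory Defs
  imports "HOL-Analysis.Analysis" "HOL-Library.Complex_Order"
begin

type_synonym qmat = "complex^2^2"

text \<open>The norm on \<open>qmap\<close> is the operator norm induced by the Frobenius norm on \<open>qmat\<close>. The type
  only enforces real linearity; complex linearity is required separately below.\<close>

type_synonym qmap = "qmat \<Rightarrow>\<^sub>L qmat"

text \<open>Operators on \<open>\<complex>\<^sup>k\<close> and on \<open>\<complex>\<^sup>k \<otimes> \<complex>\<^sup>2\<close> are given by their entries, with rows and columns
  indexed by \<open>{..<k}\<close> and by \<open>{..<k} \<times> UNIV\<close> respectively, so that \<open>k\<close> can be quantified over. Entries
  outside the index set are irrelevant. The order on \<open>complex\<close> makes \<open>0 \<le> z\<close> mean that \<open>z\<close> is real
  and non-negative; in particular \<open>psd_on\<close> implies Hermiticity.\<close>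

type_synonym bimat = "nat \<times> 2 \<Rightarrow> nat \<times> 2 \<Rightarrow> complex"

definition psd_on :: "'i set \<Rightarrow> ('i \<Rightarrow> 'i \<Rightarrow> complex) \<Rightarrow> bool" where
  "psd_on I M \<longleftrightarrow> (\<forall>v. 0 \<le> (\<Sum>i\<in>I. \<Sum>j\<in>I. cnj (v i) * M i j * v j))"

definition density_on :: "'i set \<Rightarrow> ('i \<Rightarrow> 'i \<Rightarrow> complex) \<Rightarrow> bool" where
  "density_on I M \<longleftrightarrow> psd_on I M \<and> (\<Sum>i\<in>I. M i i) = 1"

definition qpsd :: "qmat \<Rightarrow> bool" where
  "qpsd A \<longleftrightarrow> psd_on UNIV (\<lambda>i j. A $ i $ j)"

definition qdensity :: "qmat \<Rightarrow> bool" where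
  "qdensity A \<longleftrightarrow> density_on UNIV (\<lambda>i j. A $ i $ j)"

abbreviation bi_index :: "nat \<Rightarrow> (nat \<times> 2) set" where
  "bi_index k \<equiv> {..<k} \<times> UNIV"

definition tensor :: "(nat \<Rightarrow> nat \<Rightarrow> complex) \<Rightarrow> qmat \<Rightarrow> bimat" where
  "tensor \<rho> \<tau> = (\<lambda>(a, i) (b, j). \<rho> a b * \<tau> $ i $ j)"

text \<open>\<open>id\<^sub>k \<otimes> E\<close>: apply \<open>E\<close> to each of the \<open>2 \<times> 2\<close> blocks.\<close>

definition id_tensor :: "qmap \<Rightarrow> bimat \<Rightarrow> bimat" where
  "id_tensor E M = (\<lambda>(a, i) (b, j). blinfun_apply E (\<chi> i' j'. M (a, i') (b, j')) $ i $ j)"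

definition complex_linear :: "qmap \<Rightarrow> bool" where
  "complex_linear E \<longleftrightarrow> (\<forall>c A. blinfun_apply E (mat c ** A) = mat c ** blinfun_apply E A)"

lemma id_tensor_tensor:
  assumes "complex_linear E"
  shows "id_tensor E (tensor \<rho> \<tau>) = tensor \<rho> (blinfun_apply E \<tau>)"
proof -
  have scal: "mat c ** A = (\<chi> i j. c * A $ i $ j)" for c :: complex and A :: qmat
    by (simp add: matrix_matrix_mult_def mat_def vec_eq_iff if_distrib if_distribR
        sum.delta' cong: if_cong)
  have "blinfun_apply E (\<chi> i j. c * \<tau> $ i $ j) = (\<chi> i j. c * blinfun_apply E \<tau> $ i $ j)" for c
    using assms by (simp add: complex_linear_def flip: scal)
  then show ?thesis
    by (simp add: id_tensor_def tensor_def fun_eq_iff)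
qed

definition positive_map :: "qmap \<Rightarrow> bool" where
  "positive_map E \<longleftrightarrow> (\<forall>A. qpsd A \<longrightarrow> qpsd (blinfun_apply E A))"

definition completely_positive :: "qmap \<Rightarrow> bool" where
  "completely_positive E \<longleftrightarrow>
     (\<forall>k>0. \<forall>M. psd_on (bi_index k) M \<longrightarrow> psd_on (bi_index k) (id_tensor E M))"

definition trace_preserving :: "qmap \<Rightarrow> bool" where
  "trace_preserving E \<longleftrightarrow> (\<forall>A. trace (blinfun_apply E A) = trace A)"

definition qubit_channel :: "qmap \<Rightarrow> bool" where
  "qubit_channel E \<longleftrightarrow> complex_linear E \<and> completely_positive E \<and> trace_preserving E"

definition PTP :: "qmap set" where
  "PTP = {E. complex_linear E \<and> positive_map E \<and> trace_preserving E}"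

definition separable :: "nat \<Rightarrow> bimat \<Rightarrow> bool" where
  "separable k \<sigma> \<longleftrightarrow>
     (\<exists>n (p :: nat \<Rightarrow> real) \<rho> \<tau>.
        (\<forall>m<n. 0 \<le> p m \<and> density_on {..<k} (\<rho> m) \<and> qdensity (\<tau> m)) \<and>
        (\<Sum>m<n. p m) = 1 \<and>
        (\<forall>x\<in>bi_index k. \<forall>y\<in>bi_index k.
           \<sigma> x y = (\<Sum>m<n. of_real (p m) * tensor (\<rho> m) (\<tau> m) x y)))"

definition entanglement_breaking :: "qmap \<Rightarrow> bool" where
  "entanglement_breaking E \<longleftrightarrow>
     (\<forall>k>0. \<forall>\<sigma>. density_on (bi_index k) \<sigma> \<longrightarrow> separable k (id_tensor E \<sigma>))"

definition L_P :: "qmap set" where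
  "L_P = {E. qubit_channel E \<and>
     (\<forall>\<epsilon>>0. \<exists>Es. set Es \<subseteq> PTP \<and> (\<forall>F\<in>set Es. norm (F - id_blinfun) < \<epsilon>) \<and>
        E = foldr (o\<^sub>L) Es id_blinfun)}"

definition infinitesimal_divisible_PTP :: "qmap \<Rightarrow> bool" where
  "infinitesimal_divisible_PTP E \<longleftrightarrow> qubit_channel E \<and> E \<in> closure L_P"

definition sigma_x :: qmat where
  "sigma_x = vector [vector [0, 1], vector [1, 0]]"

definition sigma_y :: qmat where
  "sigma_y = vector [vector [0, - \<i>], vector [\<i>, 0]]"

definition sigma_z :: qmat where
  "sigma_z = vector [vector [1, 0], vector [0, - 1]]"

definition pauli_basis :: "qmat^4" where
  "pauli_basis = (1 / sqrt 2) *\<^sub>R vector [mat 1, sigma_x, sigma_y, sigma_z]"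

definition pauli_rep :: "qmap \<Rightarrow> complex^4^4" where
  "pauli_rep E = (\<chi> i j. trace (pauli_basis $ i ** blinfun_apply E (pauli_basis $ j)))"

end

theory Submission
  imports Defs
begin

text \<open>
  In Pauli coordinates a Hermiticity-preserving map is a real \<open>4 \<times> 4\<close> matrix \<open>R\<close>, positivity of the
  map means that \<open>R\<close> preserves the forward light cone, and \<open>X \<mapsto> A X A\<^sup>*\<close> with \<open>det A = 1\<close> acts as a
  Lorentz transformation. Testing complete positivity on the unnormalised vector state given by \<open>A\<close> yields
  \<open>tr (R \<Lambda>) \<ge> 0\<close> for every matrix \<open>\<Lambda>\<close> of this kind.

  Suppose \<open>det R \<le> 0\<close>. After mixing in a little of the completely depolarising map, the form \<open>x \<bullet> R y\<close>
  attains its minimum on pairs of points of the unit hyperboloid, and boosting the minimiser to the time axis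
  turns \<open>R\<close> into \<open>s \<oplus> T\<close>. With a singular value decomposition of \<open>T\<close> by rotations, in which
  \<open>d\<^sub>1 \<ge> d\<^sub>2 \<ge> \<bar>d\<^sub>3\<bar>\<close>, the trace condition for the rotation that reverses the first two singular
  directions reads \<open>d\<^sub>1 + d\<^sub>2 - d\<^sub>3 \<le> s\<close>; since \<open>d\<^sub>3 \<le> 0\<close> this says \<open>\<bar>d\<^sub>1\<bar> + \<bar>d\<^sub>2\<bar> + \<bar>d\<^sub>3\<bar> \<le> s\<close>, so
  \<open>R\<close> is a sum of seven products of light-cone vectors. The set of such sums is closed by compactness, so
  the mixing can be removed, and a decomposition of this kind is a measure-and-prepare form.

  If \<open>det R > 0\<close>, then \<open>R\<close> is a rotation, followed by a map onto an ellipsoid with positive diagonal linear part,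
  followed by a rotation. A rotation is a product of two reflections, and moving one mirror to the other along the
  sphere cuts it into small rotations. By the S-lemma the quadratic function of the ellipsoid can be scaled to
  dominate that of the ball; interpolating linearly between the two gives a shrinking family of ellipsoids, and
  the transition maps of this family are positive and close to the identity.
\<close>


section \<open>Pauli coordinates and conjugation maps\<close>

lemma vector_4 [simp]:
  "(vector [a, b, c, d] :: 'a::zero^4) $ 1 = a"
  "(vector [a, b, c, d] :: 'a::zero^4) $ 2 = b"
  "(vector [a, b, c, d] :: 'a::zero^4) $ 3 = c"
  "(vector [a, b, c, d] :: 'a::zero^4) $ 4 = d"
  unfolding vector_def by simp_all

lemma det_4:
  fixes A :: "'a::comm_ring_1^4^4"
  shows "det A =
    A$1$1 * (A$2$2 * (A$3$3 * A$4$4 - A$3$4 * A$4$3) - A$2$3 * (A$3$2 * A$4$4 - A$3$4 * A$4$2)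
            + A$2$4 * (A$3$2 * A$4$3 - A$3$3 * A$4$2))
  - A$1$2 * (A$2$1 * (A$3$3 * A$4$4 - A$3$4 * A$4$3) - A$2$3 * (A$3$1 * A$4$4 - A$3$4 * A$4$1)
            + A$2$4 * (A$3$1 * A$4$3 - A$3$3 * A$4$1))
  + A$1$3 * (A$2$1 * (A$3$2 * A$4$4 - A$3$4 * A$4$2) - A$2$2 * (A$3$1 * A$4$4 - A$3$4 * A$4$1)
            + A$2$4 * (A$3$1 * A$4$2 - A$3$2 * A$4$1))
  - A$1$4 * (A$2$1 * (A$3$2 * A$4$3 - A$3$3 * A$4$2) - A$2$2 * (A$3$1 * A$4$3 - A$3$3 * A$4$1)
            + A$2$3 * (A$3$1 * A$4$2 - A$3$2 * A$4$1))"
proof -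
  have f1234: "finite {2::4, 3, 4}" "1 \<notin> {2::4, 3, 4}" by auto
  have f234: "finite {3::4, 4}" "2 \<notin> {3::4, 4}" by auto
  have f34: "finite {4::4}" "3 \<notin> {4::4}" by auto
  show ?thesis
    unfolding det_def UNIV_4
    unfolding sum_over_permutations_insert[OF f1234]
    unfolding sum_over_permutations_insert[OF f234]
    unfolding sum_over_permutations_insert[OF f34]
    unfolding permutes_sing
    by (simp add: sign_swap_id permutation_swap_id permutation_compose sign_compose sign_id
        swap_id_eq algebra_simps)
qed

text \<open>The combination x1 I + x2 sigma_x + x3 sigma_y + x4 sigma_z. Without the factor 1 / sqrt
  2 its determinant is exactly the Minkowski square of \<open>x\<close>.\<close>

definition herm :: "real^4 \<Rightarrow> qmat" where
  "herm x = vector [vector [of_real (x$1 + x$4), Complex (x$2) (- x$3)],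
                    vector [Complex (x$2) (x$3), of_real (x$1 - x$4)]]"

text \<open>Writing X = H + iK with H and K Hermitian, \<open>pauli_re\<close> gives the coordinates
  of H and \<open>pauli_im\<close> those of K.\<close>

definition pauli_re :: "qmat \<Rightarrow> real^4" where
  "pauli_re X = vector [Re (X$1$1 + X$2$2) / 2, Re (X$1$2 + X$2$1) / 2,
                   Im (X$2$1 - X$1$2) / 2, Re (X$1$1 - X$2$2) / 2]"

definition pauli_im :: "qmat \<Rightarrow> real^4" where
  "pauli_im X = vector [Im (X$1$1 + X$2$2) / 2, Im (X$1$2 + X$2$1) / 2,
                   Re (X$1$2 - X$2$1) / 2, Im (X$1$1 - X$2$2) / 2]"

definition adj :: "complex^'n^'m \<Rightarrow> complex^'m^'n" where
  "adj A = (\<chi> i j. cnj (A$j$i))"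

lemma herm_nth [simp]:
  "herm x $ 1 $ 1 = of_real (x$1 + x$4)" "herm x $ 1 $ 2 = Complex (x$2) (- x$3)"
  "herm x $ 2 $ 1 = Complex (x$2) (x$3)" "herm x $ 2 $ 2 = of_real (x$1 - x$4)"
  by (simp_all add: herm_def)

lemma pauli_re_nth [simp]:
  "pauli_re X $ 1 = Re (X$1$1 + X$2$2) / 2" "pauli_re X $ 2 = Re (X$1$2 + X$2$1) / 2"
  "pauli_re X $ 3 = Im (X$2$1 - X$1$2) / 2" "pauli_re X $ 4 = Re (X$1$1 - X$2$2) / 2"
  by (simp_all add: pauli_re_def)

lemma pauli_im_nth [simp]:
  "pauli_im X $ 1 = Im (X$1$1 + X$2$2) / 2" "pauli_im X $ 2 = Im (X$1$2 + X$2$1) / 2"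
  "pauli_im X $ 3 = Re (X$1$2 - X$2$1) / 2" "pauli_im X $ 4 = Im (X$1$1 - X$2$2) / 2"
  by (simp_all add: pauli_im_def)

lemma qmat_eq_iff:
  "(X :: qmat) = Y \<longleftrightarrow> X$1$1 = Y$1$1 \<and> X$1$2 = Y$1$2 \<and> X$2$1 = Y$2$1 \<and> X$2$2 = Y$2$2"
  by (simp add: vec_eq_iff forall_2)

lemma mat_mult_nth [simp]: "(mat c ** X) $ i $ j = c * (X :: qmat) $ i $ j"
  by (simp add: matrix_matrix_mult_def mat_def if_distrib if_distribR cong: if_cong)

lemma adj_nth [simp]: "adj A $ i $ j = cnj (A $ j $ i)"
  by (simp add: adj_def)

lemma qmat_mult_nth: "(X ** Y) $ i $ j = X$i$1 * Y$1$j + X$i$2 * (Y :: qmat)$2$j"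
  by (simp add: matrix_matrix_mult_def sum_2)

lemma pauli_re_herm [simp]: "pauli_re (herm x) = x"
  by (simp add: vec_eq_iff forall_4 add_divide_distrib[symmetric])

lemma pauli_im_herm [simp]: "pauli_im (herm x) = 0"
  by (simp add: vec_eq_iff forall_4)

lemma herm_decomp: "herm (pauli_re X) + mat \<i> ** herm (pauli_im X) = X"
  by (simp add: qmat_eq_iff complex_eq_iff field_simps)

lemma linear_pauli_re: "linear pauli_re"
  by (rule linearI) (simp_all add: vec_eq_iff forall_4 field_simps)

lemma linear_pauli_im: "linear pauli_im"
  by (rule linearI) (simp_all add: vec_eq_iff forall_4 field_simps)

lemma linear_herm: "linear herm"
  by (rule linearI) (simp_all add: qmat_eq_iff complex_eq_iff field_simps)

lemma pauli_re_mat: "pauli_re (mat c ** X) = Re c *\<^sub>R pauli_re X - Im c *\<^sub>R pauli_im X"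
  by (simp add: vec_eq_iff forall_4 field_simps)

lemma pauli_im_mat: "pauli_im (mat c ** X) = Re c *\<^sub>R pauli_im X + Im c *\<^sub>R pauli_re X"
  by (simp add: vec_eq_iff forall_4 field_simps)

lemma adj_herm [simp]: "adj (herm x) = herm x"
  by (simp add: qmat_eq_iff complex_eq_iff)

lemma herm_pauli_re:
  assumes "adj X = X"
  shows "herm (pauli_re X) = X"
proof -
  have "cnj (X$j$i) = X$i$j" for i j
    by (metis adj_nth assms)
  from this[of 1 1] this[of 1 2] this[of 2 2] show ?thesis
    by (simp add: qmat_eq_iff complex_eq_iff field_simps)
qed

lemma adj_mult: "adj (A ** B) = adj B ** adj A"
  for A B :: qmat
  by (simp add: qmat_eq_iff qmat_mult_nth mult.commute)

lemma adj_adj [simp]: "adj (adj A) = A"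
  by (simp add: vec_eq_iff)

text \<open>Rotations, boosts and their products all arise in this way, and the trace condition
  obtained from complete positivity holds against every such matrix.\<close>

definition conj_mat :: "qmat \<Rightarrow> real^4^4" where
  "conj_mat A = matrix (\<lambda>x. pauli_re (A ** herm x ** adj A))"

lemma linear_conj: "linear (\<lambda>X. A ** X ** adj (A :: qmat))"
  by (rule linearI) (simp_all add: vec_eq_iff qmat_mult_nth ring_distribs scaleR_right_distrib)

lemma conj_mat_mult: "conj_mat A *v x = pauli_re (A ** herm x ** adj A)"
  unfolding conj_mat_def
  by (rule matrix_works)
     (use linear_compose[OF linear_compose[OF linear_herm linear_conj[of A]] linear_pauli_re]
       in \<open>simp add: o_def linear_matrix_vector_mul_eq\<close>)

lemma herm_conj_mat: "herm (conj_mat A *v x) = A ** herm x ** adj A"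
  unfolding conj_mat_mult by (rule herm_pauli_re) (simp add: adj_mult matrix_mul_assoc)

lemma conj_mat_compose: "conj_mat (A ** B) = conj_mat A ** conj_mat B"
proof (rule matrix_eq[THEN iffD2], rule allI)
  fix x
  have "herm (conj_mat (A ** B) *v x) = herm ((conj_mat A ** conj_mat B) *v x)"
    by (simp add: herm_conj_mat adj_mult matrix_mul_assoc flip: matrix_vector_mul_assoc)
  then show "conj_mat (A ** B) *v x = (conj_mat A ** conj_mat B) *v x"
    by (metis pauli_re_herm)
qed

lemma inner_vec4: "x \<bullet> y = x$1*y$1 + x$2*y$2 + x$3*y$3 + x$4*(y$4)" for x y :: "real^4"
  by (simp add: inner_vec_def sum_4)

lemma trace_herm: "trace (herm x ** herm y) = of_real (2 * (x \<bullet> y))"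
  by (simp add: trace_def sum_2 qmat_mult_nth inner_vec4 complex_eq_iff algebra_simps)

lemma trace_herm1: "trace (herm x) = of_real (2 * x$1)"
  by (simp add: trace_def sum_2 complex_eq_iff)

lemma inner_transpose: "x \<bullet> (transpose A *v y) = (A *v x) \<bullet> y" for A :: "real^'n^'m"
  by (simp add: transpose_matrix_vector inner_commute[of x] inner_commute[of _ y] flip: dot_lmul_matrix)

text \<open>The trace form on Hermitian matrices is twice the Euclidean inner product of their
  coordinates, and cyclicity of the trace moves \<open>A\<close> across as its adjoint. In
  particular a Hermitian \<open>A\<close> gives a symmetric matrix.\<close>

lemma transpose_conj_mat: "transpose (conj_mat A) = conj_mat (adj A)"
proof -
  have "(conj_mat A *v x) \<bullet> y = x \<bullet> (conj_mat (adj A) *v y)" for x y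
  proof -
    have "trace (herm (conj_mat A *v x) ** herm y) = trace (herm x ** herm (conj_mat (adj A) *v y))"
      unfolding herm_conj_mat adj_adj
      by (metis matrix_mul_assoc trace_mul_sym)
    then show ?thesis
      by (simp add: trace_herm)
  qed
  then have "x \<bullet> (transpose (conj_mat A) *v y) = x \<bullet> (conj_mat (adj A) *v y)" for x y
    by (simp only: inner_transpose)
  then show ?thesis
    unfolding matrix_eq using vector_eq_ldot by blast
qed

section \<open>Complex-linear extension of a real matrix acting on Hermitian coordinates\<close>

definition map_of_mat :: "real^4^4 \<Rightarrow> qmap" where
  "map_of_mat R = Blinfun (\<lambda>X. herm (R *v pauli_re X) + mat \<i> ** herm (R *v pauli_im X))"

lemma linear_mat_mult: "linear (\<lambda>X. mat c ** (X :: qmat))"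
  by (rule linearI) (simp_all add: vec_eq_iff ring_distribs)

lemma map_of_mat_apply: "blinfun_apply (map_of_mat R) X = herm (R *v pauli_re X) + mat \<i> ** herm (R *v pauli_im X)"
proof -
  have "linear (\<lambda>X. herm (R *v pauli_re X) + mat \<i> ** herm (R *v pauli_im X))"
    using linear_compose[OF linear_compose[OF linear_pauli_re matrix_vector_mul_linear[of R]] linear_herm]
      linear_compose[OF linear_compose[OF linear_compose[OF linear_pauli_im matrix_vector_mul_linear[of R]]
          linear_herm] linear_mat_mult[of \<i>]]
    by (intro linear_compose_add) (simp_all add: o_def)
  then show ?thesis
    by (simp add: map_of_mat_def bounded_linear_Blinfun_apply linear_conv_bounded_linear)
qed

lemma map_of_mat_herm [simp]: "blinfun_apply (map_of_mat R) (herm x) = herm (R *v x)"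
  by (simp add: map_of_mat_apply linear_0[OF linear_herm] qmat_eq_iff)

lemma pauli_re_map_of_mat [simp]: "pauli_re (blinfun_apply (map_of_mat R) X) = R *v pauli_re X"
  by (simp add: map_of_mat_apply linear_add[OF linear_pauli_re] pauli_re_mat)

lemma pauli_im_map_of_mat [simp]: "pauli_im (blinfun_apply (map_of_mat R) X) = R *v pauli_im X"
  by (simp add: map_of_mat_apply linear_add[OF linear_pauli_im] pauli_im_mat)

lemma qmat_eqI: "pauli_re X = pauli_re Y \<Longrightarrow> pauli_im X = pauli_im Y \<Longrightarrow> X = Y"
  by (metis herm_decomp)

lemma map_of_mat_mult: "map_of_mat (R ** S) = map_of_mat R o\<^sub>L map_of_mat S"
  by (rule blinfun_eqI, rule qmat_eqI) (simp_all add: matrix_vector_mul_assoc)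

lemma map_of_mat_1: "map_of_mat (mat 1) = id_blinfun"
  by (rule blinfun_eqI, rule qmat_eqI) simp_all

lemma linear_map_of_mat: "linear map_of_mat"
proof (rule linearI)
  show "map_of_mat (R + S) = map_of_mat R + map_of_mat S" for R S
    by (rule blinfun_eqI, rule qmat_eqI)
       (simp_all add: blinfun.add_left linear_add[OF linear_pauli_re] linear_add[OF linear_pauli_im]
         matrix_vector_mult_add_rdistrib)
  show "map_of_mat (c *\<^sub>R R) = c *\<^sub>R map_of_mat R" for c R
    by (rule blinfun_eqI, rule qmat_eqI)
       (simp_all add: blinfun.scaleR_left linear_scale[OF linear_pauli_re] linear_scale[OF linear_pauli_im]
         scaleR_matrix_vector_assoc)
qed

lemma complex_linear_map_of_mat: "complex_linear (map_of_mat R)"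
  unfolding complex_linear_def
  by (intro allI, rule qmat_eqI)
     (simp_all add: pauli_re_mat pauli_im_mat matrix_vector_mult_diff_distrib matrix_vector_right_distrib
       matrix_vector_mult_scaleR)

section \<open>Channels as real matrices\<close>

definition spat :: "real^4 \<Rightarrow> real^3" where
  "spat x = vector [x$2, x$3, x$4]"

text \<open>By \<open>qpsd_herm\<close> these are the Pauli coordinates of the positive semidefinite
  matrices.\<close>

definition forward_cone :: "(real^4) set" where
  "forward_cone = {x. norm (spat x) \<le> x$1}"

lemma spat_nth [simp]: "spat x $ 1 = x$2" "spat x $ 2 = x$3" "spat x $ 3 = x$4"
  by (simp_all add: spat_def)

lemma norm_spat: "(norm (spat x))\<^sup>2 = (x$2)\<^sup>2 + (x$3)\<^sup>2 + (x$4)\<^sup>2"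
  unfolding power2_norm_eq_inner by (simp add: inner_vec_def sum_3 power2_eq_square)

lemma forward_cone_iff: "x \<in> forward_cone \<longleftrightarrow> 0 \<le> x$1 \<and> (x$2)\<^sup>2 + (x$3)\<^sup>2 + (x$4)\<^sup>2 \<le> (x$1)\<^sup>2"
  unfolding forward_cone_def norm_spat[symmetric]
  by (auto intro: power_mono power2_le_imp_le order_trans[OF norm_ge_zero])

lemma mult_cnj_nonneg: "0 \<le> z * cnj z"
  by (simp add: less_eq_complex_def)

lemma psd_gram:
  assumes "finite I"
  shows "psd_on I (\<lambda>i j. g i * cnj (g j))"
  unfolding psd_on_def
proof
  fix v
  have "(\<Sum>i\<in>I. \<Sum>j\<in>I. cnj (v i) * (g i * cnj (g j)) * v j)
      = (\<Sum>i\<in>I. cnj (v i) * g i) * cnj (\<Sum>j\<in>I. cnj (v j) * g j)"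
    by (simp add: sum_product cnj_sum ac_simps)
  also have "0 \<le> \<dots>" by (rule mult_cnj_nonneg)
  finally show "0 \<le> (\<Sum>i\<in>I. \<Sum>j\<in>I. cnj (v i) * (g i * cnj (g j)) * v j)" .
qed

lemma psd_on_add: "psd_on I M \<Longrightarrow> psd_on I N \<Longrightarrow> psd_on I (\<lambda>i j. M i j + N i j)"
  unfolding psd_on_def
  by (simp add: distrib_left distrib_right sum.distrib add_nonneg_nonneg)

text \<open>Cholesky factorisation of a positive 2 x 2 matrix into two rank-one terms. When the
  first pivot vanishes, so does the off-diagonal entry, and a single diagonal term remains.\<close>

lemma herm_gram:
  assumes "x \<in> forward_cone"
  obtains g h :: "2 \<Rightarrow> complex" where "\<And>i j. herm x $ i $ j = g i * cnj (g j) + h i * cnj (h j)"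
proof -
  define p r where pr: "p = x$1 + x$4" "r = x$1 - x$4"
  define q where "q = Complex (x$2) (- x$3)"
  have abs4: "\<bar>x$4\<bar> \<le> x$1"
    by (rule power2_le_imp_le)
       (use assms in \<open>auto simp: forward_cone_iff intro: order_trans[rotated]\<close>)
  then have p: "0 \<le> p" and r: "0 \<le> r" by (auto simp: pr)
  have q: "(cmod q)\<^sup>2 \<le> p * r"
    using assms unfolding q_def cmod_power2 by (simp add: forward_cone_iff pr power2_eq_square algebra_simps)
  have ent: "herm x $ 1 $ 1 = of_real p" "herm x $ 1 $ 2 = q" "herm x $ 2 $ 1 = cnj q"
    "herm x $ 2 $ 2 = of_real r"
    by (simp_all add: pr q_def complex_eq_iff)
  show ?thesis
  proof (cases "p = 0")
    case True
    then have "q = 0" using q by simp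
    define u where "u = sqrt r"
    have uc: "complex_of_real u * of_real u = of_real r"
      using r by (simp add: u_def flip: of_real_mult)
    have "herm x $ i $ j
        = 0 * cnj 0 + (if i = 1 then 0 else of_real u) * cnj (if j = 1 then 0 else of_real u)" for i j
      using exhaust_2[of i] exhaust_2[of j]
      by (auto simp: ent uc True \<open>q = 0\<close> simp del: herm_nth)
    then show ?thesis
      by (rule that)
  next
    case False
    then have p0: "p > 0" using p by simp
    define s where "s = sqrt p"
    define u where "u = sqrt (r - (cmod q)\<^sup>2 / p)"
    have s: "s * s = p" "s \<noteq> 0" using p0 by (simp_all add: s_def)
    have u: "u * u = r - (cmod q)\<^sup>2 / p" using q p0 by (simp add: u_def field_simps)
    have sc: "complex_of_real s * of_real s = of_real p" using s by (metis of_real_mult)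
    have uc: "complex_of_real u * of_real u = of_real r - q * cnj q / of_real p"
      by (metis u of_real_mult of_real_diff of_real_divide complex_norm_square)
    have "herm x $ i $ j
        = (if i = 1 then of_real s else cnj q / of_real s) * cnj (if j = 1 then of_real s else cnj q / of_real s)
        + (if i = 1 then 0 else of_real u) * cnj (if j = 1 then 0 else of_real u)" for i j
      using exhaust_2[of i] exhaust_2[of j]
      by (auto simp: ent sc uc s(2) False field_simps simp del: herm_nth)
    then show ?thesis
      by (rule that)
  qed
qed

lemma qpsd_herm: "qpsd (herm x) \<longleftrightarrow> x \<in> forward_cone"
proof
  assume "x \<in> forward_cone"
  then obtain g h where "\<And>i j. herm x $ i $ j = g i * cnj (g j) + h i * cnj (h j)"
    using herm_gram by metis
  then have "(\<lambda>i j. herm x $ i $ j) = (\<lambda>i j. g i * cnj (g j) + h i * cnj (h j))"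
    by (intro ext)
  then show "qpsd (herm x)"
    unfolding qpsd_def by (simp only: psd_on_add psd_gram finite)
next
  assume "qpsd (herm x)"
  then have *: "0 \<le> (\<Sum>i\<in>UNIV. \<Sum>j\<in>UNIV. cnj (v i) * herm x $ i $ j * v j)" for v
    unfolding qpsd_def psd_on_def by blast
  define p r where pr: "p = x$1 + x$4" "r = x$1 - x$4"
  \<comment> \<open>Test vectors with a real second component, and in \<open>form'\<close> with a
    real first component; up to a phase these are all vectors.\<close>
  have form: "0 \<le> p * (a\<^sup>2 + b\<^sup>2) + r * c\<^sup>2 + 2 * c * (x$2 * a + x$3 * b)" for a b c
    using *[of "\<lambda>i. if i = 1 then Complex a (-b) else of_real c"]
    by (simp add: sum_2 less_eq_complex_def pr power2_eq_square algebra_simps)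
  have form': "0 \<le> p * c\<^sup>2 + r * (a\<^sup>2 + b\<^sup>2) + 2 * c * (x$2 * a + x$3 * b)" for a b c
    using *[of "\<lambda>i. if i = 1 then of_real c else Complex a b"]
    by (simp add: sum_2 less_eq_complex_def pr power2_eq_square algebra_simps)
  define Q where "Q = (x$2)\<^sup>2 + (x$3)\<^sup>2"
  have p: "0 \<le> p" and r: "0 \<le> r" using form[of 1 0 0] form[of 0 0 1] by auto
  \<comment> \<open>The test vectors are, up to sign, the columns of the adjugate matrix, so the
    form returns the determinant times a diagonal entry.\<close>
  have 1: "0 \<le> p * (p * r - Q)"
    using form[of "x$2" "x$3" "-p"] by (simp add: Q_def power2_eq_square algebra_simps)
  have 2: "0 \<le> r * (p * r - Q)"
    using form'[of "-r" "x$2" "x$3"] by (simp add: Q_def power2_eq_square algebra_simps)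
  have "Q \<le> p * r"
  proof (cases "p = 0 \<and> r = 0")
    case True
    then show ?thesis using form[of "-x$2" "-x$3" 1] by (simp add: Q_def power2_eq_square)
  next
    case False
    then show ?thesis using 1 2 p r by (auto simp: zero_le_mult_iff)
  qed
  then have "(x$2)\<^sup>2 + (x$3)\<^sup>2 + (x$4)\<^sup>2 \<le> (x$1)\<^sup>2"
    by (simp add: Q_def pr power2_eq_square algebra_simps)
  moreover have "0 \<le> x$1" using p r by (simp add: pr)
  ultimately show "x \<in> forward_cone" by (simp add: forward_cone_iff)
qed

text \<open>A large enough shift along the time axis enters the cone. Linearity then carries
  statements about positive matrices over to all Hermitian ones.\<close>

lemma exists_forward_cone_diff: "\<exists>y z. y \<in> forward_cone \<and> z \<in> forward_cone \<and> x = y - z"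
proof (intro exI conjI)
  let ?c = "norm (spat x) + \<bar>x$1\<bar>"
  have "spat (x + axis 1 ?c) = spat x" "spat (axis 1 ?c) = 0"
    by (simp_all add: vec_eq_iff forall_3 axis_def)
  then show "x + axis 1 ?c \<in> forward_cone" "axis 1 ?c \<in> forward_cone"
    by (simp_all add: forward_cone_def axis_def)
qed simp

lemma adj_qpsd:
  assumes "qpsd X"
  shows "adj X = X"
proof -
  have *: "0 \<le> (\<Sum>i\<in>UNIV. \<Sum>j\<in>UNIV. cnj (v i) * X $ i $ j * v j)" for v
    using assms unfolding qpsd_def psd_on_def by blast
  show ?thesis
    using *[of "\<lambda>i. if i = 1 then 1 else 0"] *[of "\<lambda>i. if i = 1 then 0 else 1"]
      *[of "\<lambda>i. 1"] *[of "\<lambda>i. if i = 1 then 1 else \<i>"]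
    by (simp add: sum_2 less_eq_complex_def qmat_eq_iff complex_eq_iff)
qed

text \<open>Positive matrices have Hermitian images, hence so do their differences, which are all
  Hermitian matrices. Thus the map is real in Pauli coordinates, and complex linearity determines it
  elsewhere.\<close>

lemma positive_map_map_of_mat:
  assumes "complex_linear E" "positive_map E"
  obtains R where "E = map_of_mat R" "\<And>x. x \<in> forward_cone \<Longrightarrow> R *v x \<in> forward_cone"
proof -
  have herm_E: "herm (pauli_re (blinfun_apply E (herm x))) = blinfun_apply E (herm x)" for x
  proof -
    obtain y z where yz: "y \<in> forward_cone" "z \<in> forward_cone" "x = y - z"
      using exists_forward_cone_diff by blast
    have "adj (blinfun_apply E (herm y)) = blinfun_apply E (herm y)" if "y \<in> forward_cone" for y
      using that assms(2) unfolding positive_map_def by (metis adj_qpsd qpsd_herm)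
    then have "herm (pauli_re (blinfun_apply E (herm y))) = blinfun_apply E (herm y)" if "y \<in> forward_cone" for y
      using that herm_pauli_re by blast
    then show ?thesis
      unfolding yz(3) using yz(1,2)
      by (simp add: linear_diff[OF linear_pauli_re] linear_diff[OF linear_herm] blinfun.diff_right)
  qed
  define R where "R = matrix (\<lambda>x. pauli_re (blinfun_apply E (herm x)))"
  have R: "R *v x = pauli_re (blinfun_apply E (herm x))" for x
    unfolding R_def
    by (rule matrix_works)
       (use linear_compose[OF linear_compose[OF linear_herm bounded_linear.linear[OF blinfun.bounded_linear_right[of E]]] linear_pauli_re]
         in \<open>simp add: o_def linear_matrix_vector_mul_eq\<close>)
  have "E = map_of_mat R"
  proof (rule blinfun_eqI)
    fix X
    have "blinfun_apply E X = blinfun_apply E (herm (pauli_re X) + mat \<i> ** herm (pauli_im X))"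
      by (simp only: herm_decomp)
    also have "\<dots> = blinfun_apply (map_of_mat R) X"
      using assms(1) by (simp add: blinfun.add_right complex_linear_def map_of_mat_apply R herm_E)
    finally show "blinfun_apply E X = blinfun_apply (map_of_mat R) X" .
  qed
  moreover have "R *v x \<in> forward_cone" if "x \<in> forward_cone" for x
    using that assms(2) unfolding positive_map_def
    by (metis map_of_mat_herm \<open>E = map_of_mat R\<close> qpsd_herm)
  ultimately show ?thesis
    by (rule that)
qed

lemma PTP_map_of_mat:
  assumes "\<And>x. (R *v x)$1 = x$1" "\<And>x. x \<in> forward_cone \<Longrightarrow> R *v x \<in> forward_cone"
  shows "map_of_mat R \<in> PTP"
proof -
  have "positive_map (map_of_mat R)"
    unfolding positive_map_def
    by (metis map_of_mat_herm adj_qpsd assms(2) herm_pauli_re qpsd_herm)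
  moreover have "trace (mat \<i> ** herm x) = \<i> * trace (herm x)" for x
    by (simp add: trace_def sum_2 algebra_simps)
  then have "trace (blinfun_apply (map_of_mat R) X) = trace X" for X
    by (subst (2) herm_decomp[symmetric])
       (simp add: map_of_mat_apply trace_add trace_herm1 assms(1))
  ultimately show ?thesis
    by (simp add: PTP_def complex_linear_map_of_mat trace_preserving_def)
qed

lemma trace_preserving_map_of_mat:
  assumes "trace_preserving (map_of_mat R)"
  shows "(R *v x)$1 = x$1"
  using assms[unfolded trace_preserving_def, rule_format, of "herm x"]
  by (simp add: trace_herm1)

text \<open>This is the case \<open>k = 1\<close>, where the first tensor factor merely relabels the
  indices.\<close>

lemma completely_positive_imp_positive:
  assumes "completely_positive E"
  shows "positive_map E"
  unfolding positive_map_def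
proof (intro allI impI)
  fix X assume X: "qpsd X"
  have sum1: "(\<Sum>x\<in>bi_index 1. f x) = (\<Sum>i\<in>UNIV. f (0, i))" for f :: "_ \<Rightarrow> complex"
    by (simp add: sum.cartesian_product' lessThan_Suc)
  have block_mat: "(\<chi> i j. X$i$j) = X" by (simp add: vec_eq_iff)
  have "psd_on (bi_index 1) (\<lambda>x y. X $ snd x $ snd y)"
    unfolding psd_on_def
  proof
    fix v :: "nat \<times> 2 \<Rightarrow> complex"
    show "0 \<le> (\<Sum>i\<in>bi_index 1. \<Sum>j\<in>bi_index 1. cnj (v i) * X $ snd i $ snd j * v j)"
      using X[unfolded qpsd_def psd_on_def, rule_format, of "\<lambda>i. v (0, i)"]
      unfolding sum1 by simp
  qed
  then have "psd_on (bi_index 1) (id_tensor E (\<lambda>x y. X $ snd x $ snd y))"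
    using assms unfolding completely_positive_def by simp
  then have "0 \<le> (\<Sum>i\<in>UNIV. \<Sum>j\<in>UNIV. cnj (v i) * blinfun_apply E X $ i $ j * v j)" for v
    unfolding psd_on_def sum1
    by (auto simp: id_tensor_def block_mat dest: spec[where x = "\<lambda>(a, i). v i"])
  then show "qpsd (blinfun_apply E X)"
    by (simp add: qpsd_def psd_on_def)
qed

lemma trace_conj_mat_nonneg:
  assumes "completely_positive (map_of_mat R)"
  shows "0 \<le> trace (R ** conj_mat A)"
proof -
  \<comment> \<open>The bijection between the natural numbers 0, 1 and the indices of a qubit;
    \<open>g\<close> is (1 \<otimes> A) W and \<open>w\<close> is W.\<close>
  define \<iota> :: "nat \<Rightarrow> 2" where "\<iota> a = (if a = 0 then 1 else 2)" for a
  define g where "g = (\<lambda>(a, i). A $ i $ \<iota> a)"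
  define M :: bimat where "M = (\<lambda>x y. g x * cnj (g y))"
  define w where "w = (\<lambda>(a, i). if i = \<iota> a then 1 else 0 :: complex)"
  have sum2: "(\<Sum>x\<in>bi_index 2. f x) = f (0, 1) + f (0, 2) + f (1, 1) + f (1, 2)"
    for f :: "_ \<Rightarrow> complex"
    by (simp add: sum.cartesian_product' numeral_2_eq_2 sum_2)
  have "psd_on (bi_index 2) M"
    unfolding M_def by (rule psd_gram) simp
  then have "psd_on (bi_index 2) (id_tensor (map_of_mat R) M)"
    using assms unfolding completely_positive_def by simp
  then have *: "0 \<le> (\<Sum>x\<in>bi_index 2. \<Sum>y\<in>bi_index 2. cnj (w x) * id_tensor (map_of_mat R) M x y * w y)"
    unfolding psd_on_def by blast
  define B where "B a b = (\<chi> i j. A $ i $ a * cnj (A $ j $ b))" for a b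
  define e where "e k = conj_mat A *v axis k 1" for k
  have her: "herm (e k) = A ** herm (axis k 1) ** adj A" for k
    by (simp add: e_def herm_conj_mat)
  \<comment> \<open>\<open>B a b\<close> is the conjugate by \<open>A\<close> of a matrix unit, and
    the matrix units are (I + sigma_z)/2, (I - sigma_z)/2 and (sigma_x \<plusminus> i
    sigma_y)/2.\<close>
  have B: "B 1 1 = herm ((1/2) *\<^sub>R (e 1 + e 4)) + mat \<i> ** herm 0"
    "B 2 2 = herm ((1/2) *\<^sub>R (e 1 - e 4)) + mat \<i> ** herm 0"
    "B 1 2 = herm ((1/2) *\<^sub>R e 2) + mat \<i> ** herm ((1/2) *\<^sub>R e 3)"
    "B 2 1 = herm ((1/2) *\<^sub>R e 2) + mat \<i> ** herm (- (1/2) *\<^sub>R e 3)"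
    unfolding linear_add[OF linear_herm] linear_scale[OF linear_herm] linear_diff[OF linear_herm] her
      linear_0[OF linear_herm] linear_neg[OF linear_herm]
    by (simp_all only: qmat_eq_iff vector_add_component mat_mult_nth)
       (simp_all add: B_def qmat_mult_nth axis_def complex_eq_iff field_simps)
  have PhiC: "blinfun_apply (map_of_mat R) (herm x + mat \<i> ** herm y) = herm (R *v x) + mat \<i> ** herm (R *v y)" for x y
    by (simp add: map_of_mat_apply linear_add[OF linear_pauli_re] linear_add[OF linear_pauli_im] pauli_re_mat pauli_im_mat)
  have minus: "R *v - x = - (R *v x)" for x
    by (simp add: vec_eq_iff matrix_vector_mult_def sum_negf)
  have "(\<Sum>x\<in>bi_index 2. \<Sum>y\<in>bi_index 2. cnj (w x) * id_tensor (map_of_mat R) M x y * w y)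
     = blinfun_apply (map_of_mat R) (B 1 1) $ 1 $ 1 + blinfun_apply (map_of_mat R) (B 1 2) $ 1 $ 2
     + blinfun_apply (map_of_mat R) (B 2 1) $ 2 $ 1 + blinfun_apply (map_of_mat R) (B 2 2) $ 2 $ 2"
    unfolding sum2 by (simp add: w_def \<iota>_def id_tensor_def M_def g_def B_def)
  also have "\<dots> = of_real ((R *v e 1)$1 + (R *v e 2)$2 + (R *v e 3)$3 + (R *v e 4)$4)"
    unfolding B PhiC
    by (simp add: matrix_vector_mult_scaleR matrix_vector_right_distrib
        matrix_vector_mult_diff_distrib minus complex_eq_iff field_simps)
  also have "(R *v e 1)$1 + (R *v e 2)$2 + (R *v e 3)$3 + (R *v e 4)$4 = trace (R ** conj_mat A)"
  proof -
    have "(R *v e k)$k = (R ** conj_mat A)$k$k" for k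
      unfolding e_def matrix_vector_mul_assoc unfolding matrix_vector_mult_basis by (simp add: column_def)
    then show ?thesis by (simp add: trace_def sum_4)
  qed
  finally show ?thesis using * by (simp add: less_eq_complex_def)
qed

lemma qubit_channel_map_of_mat:
  assumes "qubit_channel E"
  obtains R where "E = map_of_mat R" "\<And>x. (R *v x)$1 = x$1" "\<And>x. x \<in> forward_cone \<Longrightarrow> R *v x \<in> forward_cone"
    "\<And>A. 0 \<le> trace (R ** conj_mat A)"
proof -
  have cp: "completely_positive E" and "complex_linear E" "trace_preserving E"
    using assms by (auto simp: qubit_channel_def)
  then obtain R where "E = map_of_mat R" "\<And>x. x \<in> forward_cone \<Longrightarrow> R *v x \<in> forward_cone"
    using positive_map_map_of_mat completely_positive_imp_positive by blast
  then show ?thesis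
    using that trace_conj_mat_nonneg trace_preserving_map_of_mat cp \<open>trace_preserving E\<close> by metis
qed

text \<open>The two factors 1 / sqrt 2 of the orthonormal basis cancel the factor 2 in
  \<open>trace_herm\<close>, so the Pauli representation is \<open>R\<close> entry by entry.\<close>

lemma det_pauli_rep: "det (pauli_rep (map_of_mat R)) = of_real (det R)"
proof -
  have basis: "pauli_basis $ i = (1 / sqrt 2) *\<^sub>R herm (axis i 1)" for i
  proof -
    have "mat 1 = herm (axis 1 1)" "sigma_x = herm (axis 2 1)" "sigma_y = herm (axis 3 1)"
      "sigma_z = herm (axis 4 1)"
      by (simp_all add: qmat_eq_iff mat_def sigma_x_def sigma_y_def sigma_z_def axis_def complex_eq_iff)
    then show ?thesis
      using exhaust_4[of i] by (auto simp: pauli_basis_def)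
  qed
  have "pauli_rep (map_of_mat R) $ i $ j = of_real (R$i$j)" for i j
  proof -
    have "(c *\<^sub>R X) ** (c *\<^sub>R Y) = (c * c) *\<^sub>R (X ** Y)" for c and X Y :: qmat
      by (simp add: qmat_eq_iff qmat_mult_nth scaleR_conv_of_real[where 'a=complex] algebra_simps)
    moreover have "trace (c *\<^sub>R X) = c *\<^sub>R trace X" for c and X :: qmat
      by (simp add: trace_def sum_2 scaleR_add_right)
    moreover have "axis i 1 \<bullet> (R *v axis j 1) = R$i$j"
      by (simp add: inner_axis' matrix_vector_mult_basis column_def)
    moreover have "1 / sqrt 2 * (1 / sqrt 2) = 1 / 2" by simp
    ultimately show ?thesis
      by (simp only: pauli_rep_def basis blinfun.scaleR_right trace_herm map_of_mat_herm vec_lambda_beta)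
         (simp add: scaleR_conv_of_real)
  qed
  then have "pauli_rep (map_of_mat R) = (\<chi> i j. of_real (R$i$j))"
    by (simp add: vec_eq_iff)
  then show ?thesis
    by (simp add: det_def)
qed

section \<open>Rotations and singular values in dimension three\<close>

definition refl_mat :: "real^3 \<Rightarrow> real^3^3" where
  "refl_mat a = (\<chi> i j. (if i = j then 1 else 0) - 2 * a$i * a$j)"

definition diag_mat :: "'a::zero^'n \<Rightarrow> 'a^'n^'n" where
  "diag_mat d = (\<chi> i j. if i = j then d$i else 0)"

lemma refl_mat_mult: "refl_mat a *v x = x - (2 * (a \<bullet> x)) *\<^sub>R a"
  by (simp add: refl_mat_def matrix_vector_mult_def inner_vec_def sum_3 vec_eq_iff forall_3 algebra_simps)

lemma transpose_refl_mat [simp]: "transpose (refl_mat a) = refl_mat a"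
  by (simp add: refl_mat_def transpose_def vec_eq_iff ac_simps)

lemma refl_mat_square: "norm a = 1 \<Longrightarrow> refl_mat a ** refl_mat a = mat 1"
  unfolding matrix_eq
  by (simp add: refl_mat_mult inner_diff_right norm_eq_1 flip: matrix_vector_mul_assoc)

lemma orthogonal_refl_mat: "norm a = 1 \<Longrightarrow> orthogonal_matrix (refl_mat a)"
  by (simp add: orthogonal_matrix refl_mat_square)

lemma det_refl_mat: "norm a = 1 \<Longrightarrow> det (refl_mat a) = - 1"
proof -
  assume "norm a = 1"
  then have "a$1 * a$1 + a$2 * a$2 + a$3 * a$3 = 1"
    by (simp add: norm_eq_1 inner_vec_def sum_3)
  moreover have "det (refl_mat a) = 1 - 2 * (a$1 * a$1 + a$2 * a$2 + a$3 * a$3)"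
    by (simp add: refl_mat_def det_3) (simp add: algebra_simps)
  ultimately show ?thesis by simp
qed

lemma rotation_refl_mat:
  "norm a = 1 \<Longrightarrow> norm b = 1 \<Longrightarrow> rotation_matrix (refl_mat b ** refl_mat a)"
  by (simp add: rotation_matrix_def orthogonal_matrix_mul orthogonal_refl_mat det_mul det_refl_mat)

text \<open>The mirror is the bisecting plane of \<open>u\<close> and \<open>v\<close>. Equal
  lengths give |u - v|^2 = 2 (u - v) \<bullet> u, which is what carries \<open>u\<close> to
  \<open>v\<close>; a vector orthogonal to both lies in the mirror.\<close>

lemma refl_mat_diff:
  assumes "norm u = 1" "norm v = 1" "u \<noteq> v"
  defines "a \<equiv> (1 / norm (u - v)) *\<^sub>R (u - v)"
  shows "norm a = 1" "refl_mat a *v u = v" "z \<bullet> u = 0 \<Longrightarrow> z \<bullet> v = 0 \<Longrightarrow> refl_mat a *v z = z"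
proof -
  let ?n = "norm (u - v)"
  have n: "?n \<noteq> 0" using assms by simp
  show "norm a = 1" using n by (simp add: a_def)
  have "?n * ?n = 2 * ((u - v) \<bullet> u)"
    using assms(1,2) by (simp add: power2_norm_eq_inner inner_diff_left inner_diff_right
        inner_commute norm_eq_1 flip: power2_eq_square)
  moreover have "a \<bullet> u = ((u - v) \<bullet> u) / ?n"
    unfolding a_def by simp
  ultimately have "2 * (a \<bullet> u) * ?n = ?n * ?n"
    using n by simp
  then have "2 * (a \<bullet> u) = ?n"
    using n by simp
  then show "refl_mat a *v u = v"
    using n by (simp add: refl_mat_mult) (simp add: a_def)
  show "refl_mat a *v z = z" if "z \<bullet> u = 0" "z \<bullet> v = 0"
    using that by (simp add: refl_mat_mult a_def inner_diff_right inner_commute[of _ z])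
qed

lemma norm_cross3_orthonormal:
  assumes "norm a = 1" "norm b = 1" "a \<bullet> b = 0"
  shows "norm (cross3 a b) = 1"
  using norm_cross_dot[of a b] assms by (simp add: power2_eq_1_iff) (smt (verit) norm_ge_zero)

lemma inner_orthogonal_matrix:
  "orthogonal_matrix Q \<Longrightarrow> (Q *v x) \<bullet> (Q *v y) = x \<bullet> y" for Q :: "real^'n^'n"
  by (simp add: matrix_vector_mul_assoc orthogonal_matrix_def flip: inner_transpose)

lemma norm_orthogonal_matrix:
  "orthogonal_matrix Q \<Longrightarrow> norm (Q *v x) = norm x" for Q :: "real^'n^'n"
  by (simp add: norm_eq inner_orthogonal_matrix)

text \<open>The first reflection moves the first axis to its image. The second fixes that image and
  corrects the second axis. The product is again a rotation, and rotations preserve the cross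
  product, so the third axis agrees as well. If an axis is already in place, the mirror is chosen to
  contain it.\<close>

lemma rotation_eq_refl_mat:
  assumes "rotation_matrix Q"
  obtains a b where "norm a = 1" "norm b = 1" "Q = refl_mat b ** refl_mat a"
proof -
  have Q: "orthogonal_matrix Q" using assms by (simp add: rotation_matrix_def)
  let ?e1 = "axis 1 1 :: real^3" and ?e2 = "axis 2 1 :: real^3"
  let ?y1 = "Q *v ?e1" and ?y2 = "Q *v ?e2"
  have e: "norm ?e1 = 1" "norm ?e2 = 1" "?e1 \<bullet> ?e2 = 0" "?e2 \<bullet> ?e1 = 0"
    by (simp_all add: inner_axis_axis)
  then have y: "norm ?y1 = 1" "norm ?y2 = 1" "?y1 \<bullet> ?y2 = 0"
    using Q by (simp_all add: inner_orthogonal_matrix norm_orthogonal_matrix)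
  obtain a where a: "norm a = 1" "refl_mat a *v ?e1 = ?y1"
  proof (cases "?e1 = ?y1")
    case True
    then show ?thesis using that[of ?e2] e by (simp add: refl_mat_mult)
  next
    case False
    then show ?thesis using that refl_mat_diff(1,2)[OF e(1) y(1)] by blast
  qed
  let ?z = "refl_mat a *v ?e2"
  have z: "norm ?z = 1" "?y1 \<bullet> ?z = 0"
    using orthogonal_refl_mat[OF a(1)] e norm_orthogonal_matrix inner_orthogonal_matrix a(2) by metis+
  obtain b where b: "norm b = 1" "refl_mat b *v ?y1 = ?y1" "refl_mat b *v ?z = ?y2"
  proof (cases "?z = ?y2")
    case True
    then show ?thesis
      using that[of "cross3 ?y1 ?y2"] norm_cross3_orthonormal[OF y]
      by (simp add: refl_mat_mult dot_cross_self)
  next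
    case False
    then show ?thesis using that refl_mat_diff[OF z(1) y(2)] z(2) y(3) by blast
  qed
  let ?P = "refl_mat b ** refl_mat a"
  have P: "rotation_matrix ?P" using a b by (simp add: rotation_refl_mat)
  have eq: "Q *v ?e1 = ?P *v ?e1" "Q *v ?e2 = ?P *v ?e2"
    using a b by (simp_all flip: matrix_vector_mul_assoc)
  have "Q *v cross3 ?e1 ?e2 = ?P *v cross3 ?e1 ?e2"
    using cross_rotation_matrix[OF assms] cross_rotation_matrix[OF P] eq by metis
  then have eq3: "Q *v axis 3 1 = ?P *v axis 3 1"
    by (simp add: cross_basis)
  have "Q = ?P"
  proof -
    have "column i Q = column i ?P" for i
      using exhaust_3[of i] eq eq3 by (auto simp only: matrix_vector_mult_basis)
    then show ?thesis by (simp add: column_def vec_eq_iff)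
  qed
  with a(1) b(1) that show ?thesis by blast
qed

lemma rotation_frame:
  assumes "norm a = 1" "norm b = 1" "a \<bullet> b = 0"
  shows "rotation_matrix (transpose (vector [a, b, cross3 a b]))"
proof -
  let ?V = "vector [a, b, cross3 a b] :: real^3^3"
  note c = norm_cross3_orthonormal[OF assms]
  have "(?V ** transpose ?V) $ i $ j = ?V $ i \<bullet> ?V $ j" for i j
    by (simp add: matrix_matrix_mult_def transpose_def inner_vec_def)
  moreover have "b \<bullet> a = 0" using assms by (simp add: inner_commute)
  ultimately have "?V ** transpose ?V = mat 1"
    using assms c unfolding vec_eq_iff
    by (simp add: forall_3 mat_def dot_cross_self norm_eq_1)
  then have "orthogonal_matrix (transpose ?V)"
    by (simp add: orthogonal_matrix)
  moreover have "det ?V = cross3 a b \<bullet> cross3 a b"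
    by (simp add: cross3_simps)
  ultimately show ?thesis
    using c by (simp add: rotation_matrix_def norm_eq_1)
qed

text \<open>First-order condition without derivatives: if \<open>w\<close> had a component along
  \<open>x\<close>, tilting \<open>u\<close> towards \<open>x\<close> would gain linearly in the
  tilt while the norm grows only quadratically.\<close>

lemma maximizer_orthogonal:
  fixes x w :: "'a::real_inner"
  assumes max: "\<And>z. z \<in> S \<Longrightarrow> z \<bullet> w \<le> \<sigma> * norm z" and S: "subspace S"
    and u: "u \<in> S" "norm u = 1" "u \<bullet> w = \<sigma>" "0 \<le> \<sigma>" and x: "x \<in> S" "x \<bullet> u = 0"
  shows "x \<bullet> w = 0"
proof (rule ccontr)
  define c where "c = x \<bullet> w"
  assume "x \<bullet> w \<noteq> 0"
  then have c: "c\<^sup>2 > 0" by (simp add: c_def)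
  \<comment> \<open>Squaring the maximality inequality at the tilted vector and dividing by
    \<open>s * c\<^sup>2\<close>.\<close>
  have key: "2 * \<sigma> + s * c\<^sup>2 \<le> \<sigma>\<^sup>2 * s * (norm x)\<^sup>2" if s: "s > 0" for s
  proof -
    let ?z = "u + (s * c) *\<^sub>R x"
    have "?z \<in> S" using S u x by (simp add: subspace_add subspace_scale)
    then have "?z \<bullet> w \<le> \<sigma> * norm ?z" by (rule max)
    moreover have z: "?z \<bullet> w = \<sigma> + s * c\<^sup>2"
      using u by (simp add: inner_add_left c_def power2_eq_square)
    moreover have "0 \<le> \<sigma> + s * c\<^sup>2" using u s by simp
    ultimately have "(\<sigma> + s * c\<^sup>2)\<^sup>2 \<le> (\<sigma> * norm ?z)\<^sup>2"
      by (metis power_mono)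
    moreover have "(norm ?z)\<^sup>2 = 1 + s\<^sup>2 * c\<^sup>2 * (norm x)\<^sup>2"
      unfolding power2_norm_eq_inner using u(2) x(2)
      by (simp add: inner_add_left inner_add_right inner_commute norm_eq_1 power2_eq_square)
    ultimately have "s * c\<^sup>2 * (2 * \<sigma> + s * c\<^sup>2) \<le> s * c\<^sup>2 * (\<sigma>\<^sup>2 * s * (norm x)\<^sup>2)"
      by (simp add: power_mult_distrib power2_eq_square algebra_simps)
    then show ?thesis using s c by simp
  qed
  show False
  proof (cases "\<sigma> = 0")
    case True
    then show ?thesis using key[of 1] c by simp
  next
    case False
    with u have \<sigma>: "\<sigma> > 0" by simp
    \<comment> \<open>For this tilt the right-hand side of \<open>key\<close> is at most \<sigma>,
      whereas the left-hand side exceeds 2 \<sigma>.\<close>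
    let ?s = "1 / (\<sigma> * (1 + (norm x)\<^sup>2))"
    have n: "1 + (norm x)\<^sup>2 > 0" by (simp add: add_pos_nonneg)
    have "?s > 0" using \<sigma> n by simp
    have "\<sigma>\<^sup>2 * ?s * (norm x)\<^sup>2 = \<sigma> * ((norm x)\<^sup>2 / (1 + (norm x)\<^sup>2))"
      using \<sigma> n by (simp add: power2_eq_square)
    also have "\<dots> \<le> \<sigma> * 1"
      using \<sigma> n by (intro mult_left_mono) (simp_all add: divide_le_eq)
    finally show False using key[OF \<open>?s > 0\<close>] \<sigma> c \<open>?s > 0\<close>
      by (smt (verit) mult_pos_pos)
  qed
qed

text \<open>A maximum exists on the product of the two unit spheres by compactness; it is
  nonnegative because \<open>u\<close> may be replaced by its negative, and homogeneity extends the
  bound to all vectors.\<close>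

lemma bilinear_max:
  fixes T :: "real^'n^'m"
  assumes S: "subspace S" "subspace S'" and ne: "\<exists>x\<in>S. norm x = 1" "\<exists>y\<in>S'. norm y = 1"
  shows "\<exists>u\<in>S. \<exists>v\<in>S'. norm u = 1 \<and> norm v = 1 \<and> 0 \<le> u \<bullet> (T *v v) \<and>
    (\<forall>x\<in>S. \<forall>y\<in>S'. x \<bullet> (T *v y) \<le> u \<bullet> (T *v v) * (norm x * norm y))"
proof -
  let ?f = "\<lambda>p. fst p \<bullet> (T *v snd p)"
  let ?K = "(S \<inter> sphere 0 1) \<times> (S' \<inter> sphere 0 1)"
  have "compact ?K"
    using S by (intro compact_Times closed_Int_compact closed_subspace compact_sphere)
  moreover have "?K \<noteq> {}" using ne by auto
  moreover have "continuous_on ?K ?f"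
    by (intro continuous_intros matrix_vector_mult_linear_continuous_on[THEN continuous_on_compose2]) auto
  ultimately obtain p where p: "p \<in> ?K" "\<forall>q\<in>?K. ?f q \<le> ?f p"
    using continuous_attains_sup by blast
  obtain u v where uv: "p = (u, v)" by fastforce
  then have uv': "u \<in> S" "v \<in> S'" "norm u = 1" "norm v = 1" using p by auto
  have max: "x \<bullet> (T *v y) \<le> u \<bullet> (T *v v)" if "x \<in> S" "y \<in> S'" "norm x = 1" "norm y = 1" for x y
    using p that uv by auto
  have "- u \<in> S" using S uv' by (simp add: subspace_neg)
  then have pos: "0 \<le> u \<bullet> (T *v v)" using max[of "-u" v] uv' by simp
  have "x \<bullet> (T *v y) \<le> u \<bullet> (T *v v) * (norm x * norm y)" if xy: "x \<in> S" "y \<in> S'" for x y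
  proof (cases "x = 0 \<or> y = 0")
    case False
    then have "(x /\<^sub>R norm x) \<bullet> (T *v (y /\<^sub>R norm y)) \<le> u \<bullet> (T *v v)"
      using xy S by (intro max) (simp_all add: subspace_scale)
    then show ?thesis
      using False by (simp add: matrix_vector_mult_scaleR field_simps)
  qed auto
  with uv' pos show ?thesis by blast
qed

lemma transpose_mult_mult_nth:
  "(transpose (transpose (V :: real^'n^'n)) ** T ** transpose W) $ i $ j = V$i \<bullet> (T *v W$j)"
  by (simp add: matrix_matrix_mult_def matrix_vector_mult_def transpose_def inner_vec_def
      sum_distrib_left sum_distrib_right mult.assoc) (rule sum.swap)

text \<open>The bilinear form is maximised over unit pairs, then over pairs orthogonal to the first
  maximiser; the first-order conditions annihilate the off-diagonal entries. The third vectors are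
  cross products, so that both frames are rotations; the price is that \<open>d$3\<close> may be
  negative.\<close>

lemma svd3:
  fixes T :: "real^3^3"
  obtains X Y d where "rotation_matrix X" "rotation_matrix Y" "T = X ** diag_mat d ** transpose Y"
    "d$2 \<le> d$1" "\<bar>d$3\<bar> \<le> d$2"
proof -
  have unit: "\<exists>x\<in>UNIV. norm (x :: real^3) = 1"
    by (rule bexI[of _ "axis 1 1"]) simp_all
  obtain u1 v1 where 1: "norm u1 = 1" "norm v1 = 1" "0 \<le> u1 \<bullet> (T *v v1)"
      "\<And>x y. x \<bullet> (T *v y) \<le> u1 \<bullet> (T *v v1) * (norm x * norm y)"
    using bilinear_max[OF subspace_UNIV subspace_UNIV unit unit, of T] by blast
  let ?S = "{x. u1 \<bullet> x = 0}" and ?S' = "{y. v1 \<bullet> y = 0}"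
  have ex: "\<exists>x\<in>{x. u \<bullet> x = 0}. norm x = 1" for u :: "real^3"
  proof -
    \<comment> \<open>A nonzero vector orthogonal to \<open>u\<close>; the first axis serves when
      \<open>u\<close> is a multiple of the third.\<close>
    define x where "x = (if u$1 = 0 \<and> u$2 = 0 then axis 1 1 else vector [- u$2, u$1, 0] :: real^3)"
    have "x \<noteq> 0" "u \<bullet> x = 0"
      by (auto simp: x_def vec_eq_iff forall_3 inner_vec_def sum_3 axis_def)
    then show ?thesis
      by (intro bexI[of _ "x /\<^sub>R norm x"]) auto
  qed
  obtain u2 v2 where 2: "u1 \<bullet> u2 = 0" "v1 \<bullet> v2 = 0" "norm u2 = 1" "norm v2 = 1" "0 \<le> u2 \<bullet> (T *v v2)"
      "\<And>x y. u1 \<bullet> x = 0 \<Longrightarrow> v1 \<bullet> y = 0 \<Longrightarrow> x \<bullet> (T *v y) \<le> u2 \<bullet> (T *v v2) * (norm x * norm y)"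
    using bilinear_max[OF subspace_hyperplane subspace_hyperplane ex ex, of u1 v1 T] by blast
  define u3 v3 where 3: "u3 = cross3 u1 u2" "v3 = cross3 v1 v2"
  have n3: "norm u3 = 1" "norm v3 = 1"
    using 1 2 by (simp_all add: 3 norm_cross3_orthonormal)
  have o3: "u1 \<bullet> u3 = 0" "u2 \<bullet> u3 = 0" "v1 \<bullet> v3 = 0" "v2 \<bullet> v3 = 0"
    by (simp_all add: 3 dot_cross_self)
  have tr: "x \<bullet> (T *v y) = y \<bullet> (transpose T *v x)" for x y
    by (metis inner_transpose inner_commute)
  have z1: "x \<bullet> (T *v v1) = 0" if "u1 \<bullet> x = 0" for x
    by (rule maximizer_orthogonal[of UNIV _ _ u1]) (use 1(4)[of _ v1] 1 that in \<open>auto simp: inner_commute[of x u1]\<close>)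
  have z1': "u1 \<bullet> (T *v y) = 0" if "v1 \<bullet> y = 0" for y
    unfolding tr
    by (rule maximizer_orthogonal[of UNIV _ _ v1])
       (use 1(4)[of u1, unfolded tr] 1(1-3)[unfolded tr] that in \<open>auto simp: inner_commute[of y v1] ac_simps\<close>)
  have z2: "u3 \<bullet> (T *v v2) = 0"
    by (rule maximizer_orthogonal[of ?S _ _ u2])
       (use 2(6)[of _ v2] 2(1-5) o3 in \<open>auto simp: inner_commute[of u3 u2] subspace_hyperplane\<close>)
  have z2': "u2 \<bullet> (T *v v3) = 0"
    unfolding tr
    by (rule maximizer_orthogonal[of ?S' _ _ v2])
       (use 2(6)[of u2, unfolded tr] 2(1-5)[unfolded tr] o3 in \<open>auto simp: inner_commute[of v3 v2] subspace_hyperplane ac_simps\<close>)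
  let ?U = "vector [u1, u2, u3] :: real^3^3" and ?V = "vector [v1, v2, v3] :: real^3^3"
  define d where "d = (vector [u1 \<bullet> (T *v v1), u2 \<bullet> (T *v v2), u3 \<bullet> (T *v v3)] :: real^3)"
  have U: "rotation_matrix (transpose ?U)" "rotation_matrix (transpose ?V)"
    using 1 2 by (simp_all add: 3 rotation_frame)
  have D: "transpose (transpose ?U) ** T ** transpose ?V = diag_mat d"
    using z1 z1' z2 z2' 2(1,2) o3 unfolding vec_eq_iff transpose_mult_mult_nth
    by (simp add: forall_3 diag_mat_def d_def)
  have "transpose ?U ** diag_mat d ** transpose (transpose ?V)
      = (transpose ?U ** transpose (transpose ?U)) ** T ** (transpose ?V ** transpose (transpose ?V))"
    by (simp only: matrix_mul_assoc flip: D)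
  also have "\<dots> = T"
    using U by (simp add: rotation_matrix_def orthogonal_matrix_def)
  finally have T: "T = transpose ?U ** diag_mat d ** transpose (transpose ?V)" ..
  have "d$2 \<le> d$1" using 1(4)[of u2 v2] 2 by (simp add: d_def)
  \<comment> \<open>Both signs of the third left vector compete in the second maximisation.\<close>
  moreover have "d$3 \<le> d$2" "- d$3 \<le> d$2"
    using 2(6)[of u3 v3] 2(6)[of "-u3" v3] o3 n3 by (simp_all add: d_def)
  then have "\<bar>d$3\<bar> \<le> d$2" by linarith
  ultimately show ?thesis using that U T by blast
qed

section \<open>Boosts and the Lorentz normal form\<close>

definition vec4 :: "real \<Rightarrow> real^3 \<Rightarrow> real^4" where
  "vec4 c v = vector [c, v$1, v$2, v$3]"

text \<open>For \<open>c = 1\<close> this is the affine map taking z to t + T z on the Bloch ball,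
  in homogeneous coordinates.\<close>

definition block_mat :: "real \<Rightarrow> real^3 \<Rightarrow> real^3^3 \<Rightarrow> real^4^4" where
  "block_mat c t T = vector [vector [c, 0, 0, 0], vector [t$1, T$1$1, T$1$2, T$1$3],
     vector [t$2, T$2$1, T$2$2, T$2$3], vector [t$3, T$3$1, T$3$2, T$3$3]]"

lemma vec4_nth [simp]:
  "vec4 c v $ 1 = c" "vec4 c v $ 2 = v$1" "vec4 c v $ 3 = v$2" "vec4 c v $ 4 = v$3"
  by (simp_all add: vec4_def)

lemma spat_vec4 [simp]: "spat (vec4 c v) = v"
  by (simp add: vec_eq_iff forall_3)

lemma vec4_spat [simp]: "vec4 (x$1) (spat x) = x"
  by (simp add: vec_eq_iff forall_4)

lemma vec4_eq_iff: "x = y \<longleftrightarrow> x$1 = y$1 \<and> spat x = spat y"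
  by (metis vec4_spat)

lemma inner_spat: "x \<bullet> y = x$1 * y$1 + spat x \<bullet> spat y"
  by (simp add: inner_vec_def sum_4 sum_3)

lemma linear_spat: "linear spat"
  by (rule linearI) (simp_all add: vec_eq_iff forall_3)

lemmas spat_simps [simp] =
  linear_add[OF linear_spat] linear_diff[OF linear_spat] linear_scale[OF linear_spat] linear_0[OF linear_spat]

lemma block_mat_mult_vec: "block_mat c t T *v x = vec4 (c * x$1) (x$1 *\<^sub>R t + T *v spat x)"
  by (simp add: vec_eq_iff forall_4 block_mat_def matrix_vector_mult_def sum_4 sum_3)

lemma block_mat_mult: "block_mat c t T ** block_mat d s S = block_mat (c * d) (d *\<^sub>R t + T *v s) (T ** S)"
  by (simp add: matrix_eq block_mat_mult_vec matrix_vector_right_distrib scaleR_add_right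
      matrix_vector_mult_scaleR ac_simps flip: matrix_vector_mul_assoc)

lemma det_block_mat: "det (block_mat c t T) = c * det T"
  by (simp add: det_4 det_3 block_mat_def) (simp add: algebra_simps)

lemma trace_block_mat: "trace (block_mat c t T) = c + trace T"
  by (simp add: trace_def sum_4 sum_3 block_mat_def)

lemma ex_block_mat:
  assumes "\<And>x. (R *v x)$1 = c * x$1"
  obtains t T where "R = block_mat c t T"
proof -
  define T :: "real^3^3" where
    "T = vector [vector [R$2$2, R$2$3, R$2$4], vector [R$3$2, R$3$3, R$3$4], vector [R$4$2, R$4$3, R$4$4]]"
  have "R$1$k = c * (axis k 1 :: real^4)$1" for k
    using assms[of "axis k 1"] by (simp add: matrix_vector_mult_basis column_def)
  then have "R = block_mat c (spat (R *v axis 1 1)) T"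
    by (simp add: vec_eq_iff forall_4 block_mat_def T_def axis_def matrix_vector_mult_def sum_4)
  then show ?thesis by (rule that)
qed

text \<open>With s the vector of Pauli matrices, (a \<bullet> s)(x \<bullet> s)(a \<bullet> s) = 2
  (a \<bullet> x)(a \<bullet> s) - |a|^2 (x \<bullet> s). For a unit vector this is the half-turn
  about \<open>a\<close>, the negative of a reflection.\<close>

lemma conj_mat_pauli: "norm a = 1 \<Longrightarrow> conj_mat (herm (vec4 0 a)) = block_mat 1 0 (- refl_mat a)"
proof -
  assume "norm a = 1"
  then have n: "a$1 * a$1 + a$2 * a$2 + a$3 * a$3 = 1"
    by (simp add: norm_eq_1 inner_vec_def sum_3)
  have minus: "(- M) *v x = - (M *v x)" for M :: "real^3^3" and x
    by (simp add: vec_eq_iff matrix_vector_mult_def sum_negf)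
  \<comment> \<open>The squared length of \<open>a\<close> stays symbolic, which makes this a
    polynomial identity; it is set to 1 afterwards.\<close>
  have "conj_mat (herm (vec4 0 a)) *v x = block_mat (a$1 * a$1 + a$2 * a$2 + a$3 * a$3) 0
     ((a$1 * a$1 + a$2 * a$2 + a$3 * a$3 - 1) *\<^sub>R - mat 1 - refl_mat a) *v x" for x
    by (simp add: conj_mat_mult vec_eq_iff forall_4 qmat_mult_nth block_mat_mult_vec matrix_vector_mult_diff_rdistrib
        refl_mat_mult inner_vec_def sum_3 minus flip: scaleR_matrix_vector_assoc)
       (simp add: algebra_simps)
  then show ?thesis
    unfolding n by (simp add: matrix_eq)
qed

text \<open>In a product of two reflections each may be replaced by the corresponding half-turn,
  since the two signs cancel.\<close>

lemma rotation_eq_conj_mat: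
  assumes "rotation_matrix Q"
  obtains A where "conj_mat A = block_mat 1 0 Q"
proof -
  obtain a b where ab: "norm a = 1" "norm b = 1" "Q = refl_mat b ** refl_mat a"
    using assms rotation_eq_refl_mat by blast
  have "(- refl_mat b) ** (- refl_mat a) = refl_mat b ** refl_mat a"
    by (simp add: matrix_matrix_mult_def vec_eq_iff)
  then show ?thesis
    using that[of "herm (vec4 0 b) ** herm (vec4 0 a)"]
    by (simp add: conj_mat_compose conj_mat_pauli ab block_mat_mult)
qed

text \<open>The Minkowski form is written \<open>x \<bullet> flip4 y\<close>.\<close>

definition flip4 :: "real^4 \<Rightarrow> real^4" where
  "flip4 x = vec4 (x$1) (- spat x)"

definition hyperboloid :: "(real^4) set" where
  "hyperboloid = {x. 0 < x$1 \<and> x \<bullet> flip4 x = 1}"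

lemma flip4_nth1 [simp]: "flip4 x $ 1 = x$1"
  and spat_flip4 [simp]: "spat (flip4 x) = - spat x"
  by (simp_all add: flip4_def)

lemma flip4_flip4 [simp]: "flip4 (flip4 x) = x"
  by (simp add: vec4_eq_iff)

lemma flip4_axis [simp]: "flip4 (axis 1 1) = axis 1 1"
  by (simp add: flip4_def vec_eq_iff forall_4 axis_def)

lemma inner_flip4: "x \<bullet> flip4 y = x$1 * y$1 - spat x \<bullet> spat y"
  by (simp add: inner_spat)

lemma flip4_inner: "flip4 x \<bullet> y = x \<bullet> flip4 y"
  by (simp add: inner_spat)

lemma linear_flip4: "linear flip4"
  by (rule linearI) (simp_all add: vec4_eq_iff)

lemma flip4_forward_cone [simp]: "flip4 x \<in> forward_cone \<longleftrightarrow> x \<in> forward_cone"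
  by (simp add: forward_cone_def)

lemma spat_axis1 [simp]: "spat (axis 1 c) = 0"
  by (simp add: vec_eq_iff forall_3 axis_def)

lemma axis1_hyperboloid [simp]: "axis 1 1 \<in> hyperboloid"
  by (simp add: hyperboloid_def inner_flip4)

lemma hyperboloid_norm: "x \<in> hyperboloid \<Longrightarrow> (norm (spat x))\<^sup>2 = (x$1)\<^sup>2 - 1"
  unfolding power2_norm_eq_inner by (simp add: hyperboloid_def inner_flip4 power2_eq_square)

lemma hyperboloid_less:
  assumes "x \<in> hyperboloid"
  shows "norm (spat x) < x$1"
proof -
  have "(norm (spat x))\<^sup>2 < (x$1)\<^sup>2" "0 < x$1"
    using hyperboloid_norm[OF assms] assms by (auto simp: hyperboloid_def)
  then show ?thesis by (meson less_imp_le power2_less_imp_less)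
qed

lemma hyperboloid_forward_cone: "x \<in> hyperboloid \<Longrightarrow> x \<in> forward_cone"
  using hyperboloid_less by (force simp: forward_cone_def)

lemma hyperboloid_ge1:
  assumes "x \<in> hyperboloid"
  shows "1 \<le> x$1"
proof -
  have "1\<^sup>2 \<le> (x$1)\<^sup>2" "0 \<le> x$1"
    using hyperboloid_norm[OF assms] zero_le_power2[of "norm (spat x)"] assms by (auto simp: hyperboloid_def simp del: zero_le_power2)
  then show ?thesis by (rule power2_le_imp_le)
qed

lemma inner_forward_cone_nonneg:
  assumes "x \<in> forward_cone" "y \<in> forward_cone"
  shows "0 \<le> x \<bullet> y"
proof -
  have "\<bar>spat x \<bullet> spat y\<bar> \<le> norm (spat x) * norm (spat y)"
    by (rule Cauchy_Schwarz_ineq2)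
  also have "\<dots> \<le> x$1 * y$1"
    using assms by (intro mult_mono) (auto simp: forward_cone_def intro: order_trans[OF norm_ge_zero])
  finally show ?thesis by (simp add: inner_spat)
qed

lemma conj_mat_forward_cone:
  assumes "x \<in> forward_cone"
  shows "conj_mat A *v x \<in> forward_cone"
proof -
  obtain g h where gh: "\<And>i j. herm x $ i $ j = g i * cnj (g j) + h i * cnj (h j)"
    using herm_gram[OF assms] by metis
  let ?g = "\<lambda>i. A$i$1 * g 1 + A$i$2 * g 2" and ?h = "\<lambda>i. A$i$1 * h 1 + A$i$2 * h 2"
  have "(\<lambda>i j. herm (conj_mat A *v x) $ i $ j) = (\<lambda>i j. ?g i * cnj (?g j) + ?h i * cnj (?h j))"
    by (intro ext) (simp add: herm_conj_mat qmat_mult_nth gh algebra_simps del: herm_nth)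
  then have "qpsd (herm (conj_mat A *v x))"
    unfolding qpsd_def by (simp only: psd_on_add psd_gram finite)
  then show ?thesis by (simp add: qpsd_herm)
qed

lemma det_herm: "det (herm x) = of_real (x \<bullet> flip4 x)"
  unfolding inner_flip4 by (simp add: det_2 inner_vec_def sum_3 complex_eq_iff algebra_simps)

text \<open>The Minkowski square of \<open>x\<close> is the determinant of \<open>herm x\<close>,
  which conjugation by a matrix of determinant one leaves fixed; polarisation gives the bilinear
  form.\<close>

lemma conj_mat_inner_flip4:
  assumes "det A = 1"
  shows "(conj_mat A *v x) \<bullet> flip4 (conj_mat A *v y) = x \<bullet> flip4 y"
proof -
  have "det (adj A) = cnj (det A)" by (simp add: det_2)
  then have q: "(conj_mat A *v x) \<bullet> flip4 (conj_mat A *v x) = x \<bullet> flip4 x" for x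
    using det_herm[of "conj_mat A *v x"] by (simp add: herm_conj_mat det_mul assms det_herm)
  have pol: "4 * (x \<bullet> flip4 y) = (x + y) \<bullet> flip4 (x + y) - (x - y) \<bullet> flip4 (x - y)" for x y
    by (simp add: inner_flip4 inner_add_left inner_add_right inner_diff_left inner_diff_right
        inner_commute algebra_simps)
  have "4 * ((conj_mat A *v x) \<bullet> flip4 (conj_mat A *v y)) = 4 * (x \<bullet> flip4 y)"
    unfolding pol matrix_vector_right_distrib[symmetric] matrix_vector_mult_diff_distrib[symmetric] q ..
  then show ?thesis by simp
qed

text \<open>The boost taking the time axis to \<open>x\<close> is conjugation by the Hermitian square root of \<open>herm x\<close>.
  Iterating the square root exhibits the boost as a square, hence with positive determinant.\<close>

definition hyperboloid_root :: "real^4 \<Rightarrow> real^4" where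
  "hyperboloid_root x = (1 / sqrt (2 * x$1 + 2)) *\<^sub>R (x + axis 1 1)"

lemma hyperboloid_root_hyperboloid:
  assumes "x \<in> hyperboloid"
  shows "hyperboloid_root x \<in> hyperboloid"
proof -
  let ?n = "sqrt (2 * x$1 + 2)"
  have n: "?n > 0" "?n * ?n = 2 * x$1 + 2" using assms by (auto simp: hyperboloid_def)
  have "hyperboloid_root x \<bullet> flip4 (hyperboloid_root x) = ((x + axis 1 1) \<bullet> flip4 (x + axis 1 1)) / (?n * ?n)"
    by (simp add: hyperboloid_root_def linear_scale[OF linear_flip4])
  also have "(x + axis 1 1) \<bullet> flip4 (x + axis 1 1) = 2 * x$1 + 2"
    using assms by (simp add: hyperboloid_def inner_flip4 algebra_simps)
  finally have "hyperboloid_root x \<bullet> flip4 (hyperboloid_root x) = 1" using n by simp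
  moreover have "0 < hyperboloid_root x $ 1" using assms n by (simp add: hyperboloid_root_def hyperboloid_def)
  ultimately show ?thesis by (simp add: hyperboloid_def)
qed

text \<open>For X = \<open>herm x\<close> of determinant one, Cayley-Hamilton gives X^2 + I = tr(X)
  X, so (X + I)^2 = (tr X + 2) X with tr X = 2 x1.\<close>

lemma herm_hyperboloid_root_square:
  assumes "x \<in> hyperboloid"
  shows "herm (hyperboloid_root x) ** herm (hyperboloid_root x) = herm x"
proof -
  define n where "n = sqrt (2 * x$1 + 2)"
  have n: "n > 0" "n * n = 2 * x$1 + 2" using assms by (auto simp: n_def hyperboloid_def)
  have h: "x$2 * x$2 + x$3 * x$3 + x$4 * x$4 = x$1 * x$1 - 1"
    using hyperboloid_norm[OF assms] unfolding norm_spat by (simp add: power2_eq_square)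
  have "herm (hyperboloid_root x) ** herm (hyperboloid_root x)
      = (1 / (n * n)) *\<^sub>R (herm (x + axis 1 1) ** herm (x + axis 1 1))"
    unfolding hyperboloid_root_def n_def[symmetric] linear_scale[OF linear_herm]
    by (simp add: qmat_eq_iff qmat_mult_nth del: herm_nth) (simp add: scaleR_conv_of_real add_divide_distrib del: herm_nth)
  also have "herm (x + axis 1 1) ** herm (x + axis 1 1) = (n * n) *\<^sub>R herm x"
    unfolding n(2) using h
    by (simp add: qmat_eq_iff qmat_mult_nth complex_eq_iff axis_def algebra_simps)
  finally show ?thesis using n(1) by simp
qed

lemma boost:
  assumes "x \<in> hyperboloid"
  obtains A where "transpose (conj_mat A) = conj_mat A" "conj_mat A *v axis 1 1 = x"
    "\<And>y. conj_mat A *v flip4 (conj_mat A *v y) = flip4 y" "0 < det (conj_mat A)"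
proof -
  let ?A = "herm (hyperboloid_root x)" and ?L = "conj_mat (herm (hyperboloid_root x))" and ?N = "conj_mat (herm (hyperboloid_root (hyperboloid_root x)))"
  have "herm (axis 1 1) = mat 1"
    by (simp add: qmat_eq_iff mat_def axis_def complex_eq_iff)
  then have "herm (?L *v axis 1 1) = herm x"
    using herm_hyperboloid_root_square[OF assms] by (simp add: herm_conj_mat)
  then have "?L *v axis 1 1 = x"
    by (metis pauli_re_herm)
  moreover have sym: "transpose ?L = ?L"
    by (simp add: transpose_conj_mat)
  moreover have inv: "?L *v flip4 (?L *v y) = flip4 y" for y
  proof -
    have "det ?A = 1"
      using hyperboloid_root_hyperboloid[OF assms] by (simp add: det_herm hyperboloid_def)
    then have "z \<bullet> (transpose ?L *v flip4 (?L *v y)) = z \<bullet> flip4 y" for z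
      by (simp only: inner_transpose conj_mat_inner_flip4)
    then show ?thesis
      unfolding sym using vector_eq_ldot by blast
  qed
  moreover have "0 < det ?L"
  proof -
    have "?L = ?N ** ?N"
      by (simp add: herm_hyperboloid_root_square hyperboloid_root_hyperboloid assms flip: conj_mat_compose)
    then have "0 \<le> det ?L" by (simp add: det_mul)
    moreover have "inj ((*v) ?L)"
      by (rule injI) (metis inv flip4_flip4)
    then have "det ?L \<noteq> 0"
      by (metis invertible_det_nz invertible_left_inverse matrix_left_invertible_injective)
    ultimately show ?thesis by simp
  qed
  ultimately show ?thesis using that by blast
qed

text \<open>The lower bound places \<open>w\<close> strictly inside the cone, so its normalised flip
  lies on the hyperboloid and yields s^2 \<le> w \<bullet> flip4 w. Hence the difference v = w - s
  flip4 y is not spacelike, while v \<bullet> y = 0 with \<open>y\<close> timelike; by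
  Cauchy-Schwarz such a v vanishes.\<close>

lemma hyperboloid_critical:
  assumes y: "y \<in> hyperboloid" and s: "w \<bullet> y = s" "0 < s" and min: "\<And>z. z \<in> hyperboloid \<Longrightarrow> s \<le> w \<bullet> z"
    and \<delta>: "0 < \<delta>" "\<And>z. z \<in> forward_cone \<Longrightarrow> \<delta> * z$1 \<le> w \<bullet> z"
  shows "w = s *\<^sub>R flip4 y"
proof -
  let ?n = "norm (spat w)"
  have less: "?n < w$1"
  proof (cases "?n = 0")
    case True
    have "axis 1 1 \<in> forward_cone" by (simp add: hyperboloid_forward_cone)
    then show ?thesis using \<delta>(2)[of "axis 1 1"] \<delta>(1) True by (simp add: inner_axis)
  next
    case False
    \<comment> \<open>A lightlike vector pointing against the spatial part of \<open>w\<close>,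
      where the value of \<open>w\<close> relative to time is least.\<close>
    have "vec4 ?n (- spat w) \<in> forward_cone" by (simp add: forward_cone_def)
    then have "\<delta> * ?n \<le> w$1 * ?n - ?n * ?n"
      using \<delta>(2)[of "vec4 ?n (- spat w)"] by (simp add: inner_spat flip: power2_norm_eq_inner power2_eq_square)
    then have "\<delta> * ?n \<le> (w$1 - ?n) * ?n" by (simp add: algebra_simps)
    then show ?thesis using False \<delta>(1) by simp
  qed
  define m where "m = sqrt (w \<bullet> flip4 w)"
  have w1: "0 < w$1" using less norm_ge_zero[of "spat w"] by linarith
  have "?n * ?n < w$1 * w$1"
    using less w1 by (intro mult_strict_mono) auto
  then have q: "0 < w \<bullet> flip4 w"
    by (simp add: inner_flip4 flip: power2_norm_eq_inner power2_eq_square)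
  then have m: "0 < m" "m * m = w \<bullet> flip4 w" by (simp_all add: m_def)
  let ?z = "(1 / m) *\<^sub>R flip4 w"
  have "w \<bullet> ?z = m" using m by (simp add: field_simps)
  moreover have "?z \<in> hyperboloid"
    using m w1 q
    by (simp add: hyperboloid_def linear_scale[OF linear_flip4] flip4_inner)
  ultimately have "s \<le> m" using min by metis
  then have "s * s \<le> m * m" using s(2) by (intro mult_mono) auto
  define v where "v = w - s *\<^sub>R flip4 y"
  have vy: "v \<bullet> y = 0"
    using y s(1) by (simp add: v_def inner_diff_left hyperboloid_def flip4_inner)
  have "v \<bullet> flip4 v = w \<bullet> flip4 w - 2 * s * (w \<bullet> y) + s * s * (y \<bullet> flip4 y)"
    by (simp add: v_def linear_diff[OF linear_flip4] linear_scale[OF linear_flip4] inner_diff_left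
        inner_diff_right flip4_inner inner_commute[of y w] algebra_simps)
  also have "\<dots> = m * m - s * s"
    using y s(1) m by (simp add: hyperboloid_def)
  finally have "0 \<le> v \<bullet> flip4 v" using \<open>s * s \<le> m * m\<close> by simp
  then have "(norm (spat v))\<^sup>2 \<le> \<bar>v$1\<bar>\<^sup>2"
    unfolding power2_norm_eq_inner by (simp add: inner_flip4 power2_eq_square)
  then have nv: "norm (spat v) \<le> \<bar>v$1\<bar>"
    by (rule power2_le_imp_le) simp
  have "v$1 * y$1 = - (spat v \<bullet> spat y)" "0 < y$1"
    using vy y by (simp_all add: inner_spat hyperboloid_def)
  then have "\<bar>v$1\<bar> * y$1 = \<bar>spat v \<bullet> spat y\<bar>"
    by (metis abs_minus_cancel abs_mult abs_of_pos)
  also have "\<dots> \<le> norm (spat v) * norm (spat y)" by (rule Cauchy_Schwarz_ineq2)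
  also have "\<dots> \<le> \<bar>v$1\<bar> * norm (spat y)" using nv by (simp add: mult_right_mono)
  finally have "\<bar>v$1\<bar> * (y$1 - norm (spat y)) \<le> 0" by (simp add: algebra_simps)
  then have "v$1 = 0" using hyperboloid_less[OF y] by (simp add: mult_le_0_iff)
  then have "v = 0" using nv by (simp add: vec4_eq_iff)
  then show ?thesis by (simp add: v_def)
qed

text \<open>The bound by \<delta> makes the form coercive, so its infimum over pairs is attained on
  a compact piece. The minimiser is critical in each variable separately, and
  \<open>hyperboloid_critical\<close> applies to \<open>R\<close> and to its transpose.\<close>

lemma hyperboloid_minimizer:
  fixes R :: "real^4^4"
  assumes \<delta>: "0 < \<delta>" and R: "\<And>x y. x \<in> forward_cone \<Longrightarrow> y \<in> forward_cone \<Longrightarrow> \<delta> * (x$1 * y$1) \<le> x \<bullet> (R *v y)"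
  obtains x y s where "x \<in> hyperboloid" "y \<in> hyperboloid" "0 < s" "R *v y = s *\<^sub>R flip4 x" "transpose R *v x = s *\<^sub>R flip4 y"
proof -
  let ?f = "\<lambda>p. fst p \<bullet> (R *v snd p)"
  let ?e = "axis 1 1 :: real^4"
  \<comment> \<open>Time coordinates on the hyperboloid are at least 1, so a pair with one
    coordinate above \<open>C\<close> has value at least \<delta> C, the value at the pair of time
    axes.\<close>
  define C where "C = ?f (?e, ?e) / \<delta>"
  define K where "K = {x \<in> hyperboloid. x$1 \<le> C}"
  have "K = {x. 1 \<le> x$1} \<inter> {x. x$1 \<le> C} \<inter> {x. x \<bullet> flip4 x = 1}"
    by (auto simp: K_def hyperboloid_ge1) (auto simp: hyperboloid_def)
  moreover have "closed ({x :: real^4. 1 \<le> x$1} \<inter> {x. x$1 \<le> C} \<inter> {x. x \<bullet> flip4 x = 1})"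
    by (intro closed_Int closed_Collect_le closed_Collect_eq continuous_intros
        linear_continuous_on linear_flip4[unfolded linear_conv_bounded_linear])
  moreover have "bounded K"
  proof (rule boundedI)
    fix x assume x: "x \<in> K"
    then have "\<bar>x$1\<bar> \<le> C" "norm (spat x) \<le> C"
      using hyperboloid_less[of x] by (auto simp: K_def hyperboloid_def)
    moreover have "x = vec4 (x$1) 0 + vec4 0 (spat x)" by (simp add: vec_eq_iff forall_4)
    then have "norm x \<le> norm (vec4 (x$1) 0) + norm (vec4 0 (spat x))" by (metis norm_triangle_ineq)
    moreover have "norm (vec4 (x$1) 0) = \<bar>x$1\<bar>" "norm (vec4 0 (spat x)) = norm (spat x)"
      by (simp_all add: norm_eq_sqrt_inner inner_spat)
    ultimately show "norm x \<le> 2 * C" by simp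
  qed
  ultimately have "compact K" by (simp add: compact_eq_bounded_closed)
  then have "compact (K \<times> K)" by (simp add: compact_Times)
  have e: "?e \<in> forward_cone" by (simp add: hyperboloid_forward_cone)
  then have "?e \<in> K"
    using R[of ?e ?e] \<delta> by (simp add: K_def C_def field_simps)
  then have ne: "K \<times> K \<noteq> {}" by blast
  have "continuous_on (K \<times> K) ?f"
    by (intro continuous_intros matrix_vector_mult_linear_continuous_on[THEN continuous_on_compose2]) auto
  from continuous_attains_inf[OF \<open>compact (K \<times> K)\<close> ne this]
  obtain p where p: "p \<in> K \<times> K" "\<forall>q\<in>K \<times> K. ?f p \<le> ?f q"
    by (elim bexE)
  obtain x y where xy: "p = (x, y)" by fastforce
  let ?s = "x \<bullet> (R *v y)"
  have hyperboloid: "x \<in> hyperboloid" "y \<in> hyperboloid" using p(1) xy by (auto simp: K_def)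
  have min: "?s \<le> x' \<bullet> (R *v y')" if "x' \<in> hyperboloid" "y' \<in> hyperboloid" for x' y'
  proof (cases "x' \<in> K \<and> y' \<in> K")
    case True
    then show ?thesis using p xy by auto
  next
    case False
    have x1: "1 \<le> x'$1" "1 \<le> y'$1" using that by (auto dest: hyperboloid_ge1)
    have "?s \<le> ?f (?e, ?e)" using p xy \<open>?e \<in> K\<close> by (auto dest: bspec[of _ _ "(?e, ?e)"])
    also have "\<dots> = \<delta> * C" using \<delta> by (simp add: C_def)
    also have "C \<le> x'$1 * y'$1"
    proof (cases "x'$1 \<le> C")
      case True
      then have "C < y'$1" using False that by (auto simp: K_def)
      then show ?thesis using mult_right_mono[of 1 "x'$1" "y'$1"] x1 by linarith
    next
      case False
      then show ?thesis using mult_left_mono[of 1 "y'$1" "x'$1"] x1 by linarith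
    qed
    then have "\<delta> * C \<le> \<delta> * (x'$1 * y'$1)" using \<delta> by simp
    also have "\<dots> \<le> x' \<bullet> (R *v y')" using that by (intro R hyperboloid_forward_cone)
    finally show ?thesis .
  qed
  have x1: "0 < x$1" "0 < y$1" using hyperboloid by (auto simp: hyperboloid_def)
  have "0 < \<delta> * (x$1 * y$1)" using \<delta> x1 by simp
  also have "\<dots> \<le> ?s" using hyperboloid by (intro R hyperboloid_forward_cone)
  finally have s: "0 < ?s" .
  have "R *v y = ?s *\<^sub>R flip4 x"
    by (rule hyperboloid_critical[of _ _ _ "\<delta> * y$1"])
       (use hyperboloid s x1 \<delta> min R[OF _ hyperboloid_forward_cone[OF hyperboloid(2)]] in \<open>auto simp: inner_commute mult_ac\<close>)
  moreover have tr: "(transpose R *v x) \<bullet> z = x \<bullet> (R *v z)" for z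
    by (metis inner_commute inner_transpose)
  have "transpose R *v x = ?s *\<^sub>R flip4 y"
    by (rule hyperboloid_critical[of _ _ _ "\<delta> * x$1"])
       (use hyperboloid s x1 \<delta> min R[OF hyperboloid_forward_cone[OF hyperboloid(1)]] in \<open>auto simp: tr dot_lmul_matrix mult_ac\<close>)
  ultimately show ?thesis using that hyperboloid s by blast
qed

section \<open>Decomposition into products of light-cone vectors\<close>

definition outer :: "real^'m \<Rightarrow> real^'n \<Rightarrow> real^'n^'m" where
  "outer u v = (\<chi> i j. u$i * v$j)"

lemma outer_mult_vec: "outer u v *v x = (v \<bullet> x) *\<^sub>R u"
  by (simp add: outer_def matrix_vector_mult_def inner_vec_def vec_eq_iff sum_distrib_left ac_simps)

lemma sum_mult_vec: "(\<Sum>m\<in>S. M m) *v x = (\<Sum>m\<in>S. M m *v x)" for M :: "'i \<Rightarrow> real^'n^'m"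
  by (induction S rule: infinite_finite_induct) (simp_all add: matrix_vector_mult_add_rdistrib)

lemma block_mat_add: "block_mat c t T + block_mat d s S = block_mat (c + d) (t + s) (T + S)"
  by (simp add: vec_eq_iff forall_4 block_mat_def)

text \<open>The boosts carry the time axis to the two minimisers. After applying them, the time axis
  is an eigenvector both of the matrix and of its transpose, which forces block diagonal
  form.\<close>

lemma normal_form:
  fixes R :: "real^4^4"
  assumes "0 < \<delta>" "\<And>x y. x \<in> forward_cone \<Longrightarrow> y \<in> forward_cone \<Longrightarrow> \<delta> * (x$1 * y$1) \<le> x \<bullet> (R *v y)"
  obtains A B s T where "conj_mat A ** R ** conj_mat B = block_mat s 0 T" "0 < s"
    "transpose (conj_mat B) = conj_mat B" "0 < det (conj_mat A)" "0 < det (conj_mat B)"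
    "\<And>y. conj_mat A *v flip4 (conj_mat A *v y) = flip4 y" "\<And>y. conj_mat B *v flip4 (conj_mat B *v y) = flip4 y"
proof -
  let ?e = "axis 1 1 :: real^4"
  obtain x y s where xy: "x \<in> hyperboloid" "y \<in> hyperboloid" and s: "0 < s"
    and R: "R *v y = s *\<^sub>R flip4 x" "transpose R *v x = s *\<^sub>R flip4 y"
    using hyperboloid_minimizer[OF assms] by blast
  obtain A where A: "transpose (conj_mat A) = conj_mat A" "conj_mat A *v ?e = x"
    "\<And>y. conj_mat A *v flip4 (conj_mat A *v y) = flip4 y" "0 < det (conj_mat A)"
    using boost[OF xy(1)] by blast
  obtain B where B: "transpose (conj_mat B) = conj_mat B" "conj_mat B *v ?e = y"
    "\<And>y. conj_mat B *v flip4 (conj_mat B *v y) = flip4 y" "0 < det (conj_mat B)"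
    using boost[OF xy(2)] by blast
  let ?M = "conj_mat A ** R ** conj_mat B"
  have "?M *v ?e = s *\<^sub>R (conj_mat A *v flip4 (conj_mat A *v ?e))"
    unfolding matrix_vector_mul_assoc[symmetric] A(2) B(2) R(1) by (simp add: matrix_vector_mult_scaleR)
  then have Me: "?M *v ?e = s *\<^sub>R ?e" by (simp only: A(3) flip4_axis)
  have "transpose ?M *v ?e = s *\<^sub>R (conj_mat B *v flip4 (conj_mat B *v ?e))"
    unfolding matrix_transpose_mul A(1) B(1) matrix_vector_mul_assoc[symmetric] A(2) B(2) R(2)
    by (simp add: matrix_vector_mult_scaleR)
  then have "transpose ?M *v ?e = s *\<^sub>R ?e" by (simp only: B(3) flip4_axis)
  then have "(?M *v z) $ 1 = s * z$1" for z
    using inner_transpose[of z ?M ?e] by (simp only: inner_scaleR_right) (simp add: inner_axis)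
  then obtain t T where M: "?M = block_mat s t T" using ex_block_mat by blast
  have "t = 0"
    using Me unfolding M block_mat_mult_vec vec4_eq_iff by simp
  with that M A B s show ?thesis by blast
qed

lemma det_diag3: "det (diag_mat d) = d$1 * d$2 * (d$3 :: real)" for d :: "real^3"
  by (simp add: det_3 diag_mat_def)

text \<open>The test rotation is Y diag(-1, -1, 1) X^T, for which the trace is - d1 - d2 + d3. The
  determinant condition and the ordering exclude d3 > 0, so d3 = - |d3|.\<close>

lemma trace_rotation_bound:
  fixes T :: "real^3^3"
  assumes rot: "\<And>Q. rotation_matrix Q \<Longrightarrow> 0 \<le> s + trace (T ** Q)" and det: "det T \<le> 0"
    and T: "T = X ** diag_mat d ** transpose Y" "rotation_matrix X" "rotation_matrix Y"
    and d: "d$2 \<le> d$1" "\<bar>d$3\<bar> \<le> d$2"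
  shows "\<bar>d$1\<bar> + \<bar>d$2\<bar> + \<bar>d$3\<bar> \<le> s"
proof -
  let ?D = "diag_mat (vector [-1, -1, 1]) :: real^3^3"
  have tr: "transpose X ** X = mat 1" "transpose Y ** Y = mat 1" "det X = 1" "det Y = 1"
    using T(2,3) by (auto simp: rotation_matrix_def orthogonal_matrix)
  have "transpose ?D = ?D" "?D ** ?D = mat 1"
    by (simp_all add: diag_mat_def transpose_def vec_eq_iff matrix_matrix_mult_def mat_def forall_3 sum_3)
  then have "rotation_matrix ?D"
    by (simp add: rotation_matrix_def orthogonal_matrix det_diag3)
  then have "rotation_matrix (Y ** ?D ** transpose X)"
    using T(2,3) by (simp add: rotation_matrix_def orthogonal_matrix_mul det_mul orthogonal_matrix_transpose)
  note rot[OF this]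
  also have "T ** (Y ** ?D ** transpose X) = X ** (diag_mat d ** (transpose Y ** Y) ** ?D) ** transpose X"
    by (simp only: T(1) matrix_mul_assoc)
  also have "trace \<dots> = trace (transpose X ** X ** (diag_mat d ** (transpose Y ** Y) ** ?D))"
    by (subst trace_mul_sym) (simp only: matrix_mul_assoc)
  also have "\<dots> = - d$1 - d$2 + d$3"
    unfolding tr matrix_mul_lid matrix_mul_rid by (simp add: trace_def sum_3 diag_mat_def matrix_matrix_mult_def)
  finally have *: "0 \<le> s - d$1 - d$2 + d$3" by simp
  have prod: "d$1 * d$2 * d$3 \<le> 0"
    using det tr by (simp add: T(1) det_mul det_diag3)
  have "d$3 \<le> 0"
  proof (rule ccontr)
    assume "\<not> d$3 \<le> 0"
    then have "0 < d$3" "0 < d$2" "0 < d$1" using d by auto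
    then have "0 < d$1 * d$2 * d$3" by simp
    then show False using prod by simp
  qed
  then show ?thesis using * d by simp
qed

text \<open>Averaging the products of (1, x) with (1, y) and of (1, -x) with (1, -y) cancels the
  mixed entries. Each singular direction contributes such a pair with weight |d_k|, its sign being
  absorbed into \<open>y\<close>; the remaining weight goes to the time axis, giving 1 + 3 * 2 = 7
  terms.\<close>

lemma block_mat_diag_decomp:
  assumes T: "T = X ** diag_mat d ** transpose Y" "orthogonal_matrix X" "orthogonal_matrix Y"
    and d: "\<bar>d$1\<bar> + \<bar>d$2\<bar> + \<bar>d$3\<bar> \<le> s"
  shows "\<exists>u v. (\<forall>m<7. u m \<in> forward_cone \<and> v m \<in> forward_cone) \<and> block_mat s 0 T = (\<Sum>m<(7::nat). outer (u m) (v m))"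
proof -
  define x where "x k = column k X" for k
  define y where "y k = sgn (d$k) *\<^sub>R column k Y" for k
  have unit: "norm (column k Q) = 1" if "orthogonal_matrix Q" for k and Q :: "real^3^3"
    using that norm_orthogonal_matrix[of Q "axis k 1"] by (simp add: matrix_vector_mult_basis)
  define u v where
    "u = (\<lambda>m. [(s - (\<bar>d$1\<bar> + \<bar>d$2\<bar> + \<bar>d$3\<bar>)) *\<^sub>R vec4 1 0,
       (\<bar>d$1\<bar> / 2) *\<^sub>R vec4 1 (x 1), (\<bar>d$1\<bar> / 2) *\<^sub>R vec4 1 (- x 1),
       (\<bar>d$2\<bar> / 2) *\<^sub>R vec4 1 (x 2), (\<bar>d$2\<bar> / 2) *\<^sub>R vec4 1 (- x 2),
       (\<bar>d$3\<bar> / 2) *\<^sub>R vec4 1 (x 3), (\<bar>d$3\<bar> / 2) *\<^sub>R vec4 1 (- x 3)] ! m)" and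
    "v = (\<lambda>m. [vec4 1 0, vec4 1 (y 1), vec4 1 (- y 1), vec4 1 (y 2), vec4 1 (- y 2),
       vec4 1 (y 3), vec4 1 (- y 3)] ! m)"
  have seven: "(m::nat) < 7 \<longleftrightarrow> m = 0 \<or> m = 1 \<or> m = 2 \<or> m = 3 \<or> m = 4 \<or> m = 5 \<or> m = 6" for m
    by auto
  have cone: "vec4 1 a \<in> forward_cone" if "norm a \<le> 1" for a using that by (simp add: forward_cone_def)
  have scale: "c *\<^sub>R a \<in> forward_cone" if "a \<in> forward_cone" "0 \<le> c" for a c
    using that by (simp add: forward_cone_def mult_left_mono)
  have x: "norm (x k) \<le> 1" for k using unit[OF T(2)] by (simp add: x_def)
  have y: "norm (y k) \<le> 1" for k
    using unit[OF T(3)] by (simp add: y_def abs_sgn_eq)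
  have 1: "u m \<in> forward_cone" if "m < 7" for m
    using that d unfolding seven by (auto simp: u_def intro!: scale cone x)
  have 2: "v m \<in> forward_cone" if "m < 7" for m
    using that unfolding seven by (auto simp: v_def intro!: cone y)
  have T': "T = d$1 *\<^sub>R outer (x 1) (column 1 Y) + d$2 *\<^sub>R outer (x 2) (column 2 Y)
      + d$3 *\<^sub>R outer (x 3) (column 3 Y)"
  proof -
    have "(X ** diag_mat d) $ i $ k = X$i$k * d$k" for i k
      by (simp add: matrix_matrix_mult_def diag_mat_def if_distrib cong: if_cong)
    then show ?thesis
      unfolding T(1) by (simp add: vec_eq_iff outer_def x_def column_def transpose_def
          matrix_matrix_mult_def[of "X ** diag_mat d"] sum_3)
  qed
  have "outer a (sgn c *\<^sub>R b) = sgn c *\<^sub>R outer a b" for a b :: "real^3" and c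
    by (simp add: outer_def vec_eq_iff)
  then have xy: "\<bar>d$k\<bar> *\<^sub>R outer (x k) (y k) = d$k *\<^sub>R outer (x k) (column k Y)" for k
    by (simp add: y_def abs_mult_sgn)
  have "(\<Sum>m<(7::nat). outer (u m) (v m)) = outer (u 0) (v 0) + (outer (u 1) (v 1) + outer (u 2) (v 2))
      + (outer (u 3) (v 3) + outer (u 4) (v 4)) + (outer (u 5) (v 5) + outer (u 6) (v 6))"
    by (simp add: eval_nat_numeral)
  also have "\<dots> = block_mat (s - (\<bar>d$1\<bar> + \<bar>d$2\<bar> + \<bar>d$3\<bar>)) 0 0 + block_mat \<bar>d$1\<bar> 0 (\<bar>d$1\<bar> *\<^sub>R outer (x 1) (y 1))
      + block_mat \<bar>d$2\<bar> 0 (\<bar>d$2\<bar> *\<^sub>R outer (x 2) (y 2)) + block_mat \<bar>d$3\<bar> 0 (\<bar>d$3\<bar> *\<^sub>R outer (x 3) (y 3))"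
  proof -
    have "outer ((c / 2) *\<^sub>R vec4 1 a) (vec4 1 b) + outer ((c / 2) *\<^sub>R vec4 1 (- a)) (vec4 1 (- b))
        = block_mat c 0 (c *\<^sub>R outer a b)" for c a b
      by (simp add: vec_eq_iff forall_4 outer_def block_mat_def)
    moreover have "outer (c *\<^sub>R vec4 1 0) (vec4 1 0) = block_mat c 0 0" for c
      by (simp add: vec_eq_iff forall_4 outer_def block_mat_def)
    ultimately show ?thesis
      by (simp add: u_def v_def)
  qed
  also have "\<dots> = block_mat s 0 T"
    unfolding block_mat_add xy T' by simp
  finally show ?thesis using 1 2 by metis
qed

text \<open>The sign of the determinant and the trace condition both pass to the normal form, where
  the seven terms are available. The inverse boosts carry these terms back and preserve the
  cone.\<close>

lemma strict_separable:
  fixes R :: "real^4^4"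
  assumes \<delta>: "0 < \<delta>" "\<And>x y. x \<in> forward_cone \<Longrightarrow> y \<in> forward_cone \<Longrightarrow> \<delta> * (x$1 * y$1) \<le> x \<bullet> (R *v y)"
    and trace: "\<And>A. 0 \<le> trace (R ** conj_mat A)" and det: "det R \<le> 0"
  shows "\<exists>u v. (\<forall>m<7. u m \<in> forward_cone \<and> v m \<in> forward_cone) \<and> R = (\<Sum>m<(7::nat). outer (u m) (v m))"
proof -
  obtain A B s T where eq: "conj_mat A ** R ** conj_mat B = block_mat s 0 T" and s: "0 < s"
    and sym: "transpose (conj_mat B) = conj_mat B" and pos: "0 < det (conj_mat A)" "0 < det (conj_mat B)"
    and inv: "\<And>y. conj_mat A *v flip4 (conj_mat A *v y) = flip4 y" "\<And>y. conj_mat B *v flip4 (conj_mat B *v y) = flip4 y"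
    using normal_form[OF \<delta>] by blast
  obtain X Y d where svd: "rotation_matrix X" "rotation_matrix Y" "T = X ** diag_mat d ** transpose Y"
    "d$2 \<le> d$1" "\<bar>d$3\<bar> \<le> d$2"
    by (rule svd3)
  have "s * det T = det (conj_mat A) * det R * det (conj_mat B)"
    by (simp only: det_block_mat[of s 0 T, symmetric] eq[symmetric] det_mul)
  also have "\<dots> \<le> 0" using pos det by (simp add: mult_le_0_iff)
  finally have "det T \<le> 0" using s by (simp add: mult_le_0_iff)
  note det_T = this
  have rot: "0 \<le> s + trace (T ** Q)" if Q: "rotation_matrix Q" for Q
  proof -
    obtain C where C: "conj_mat C = block_mat 1 0 Q" using rotation_eq_conj_mat[OF Q] by blast
    \<comment> \<open>Cyclicity collects the boosts and the rotation into one conjugation to the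
      right of \<open>R\<close>.\<close>
    have "s + trace (T ** Q) = trace (conj_mat A ** (R ** conj_mat B ** conj_mat C))"
      by (simp add: trace_block_mat[symmetric, of s _ 0] C matrix_mul_assoc eq block_mat_mult)
    also have "\<dots> = trace (R ** conj_mat (B ** C ** A))"
      by (subst trace_mul_sym) (simp add: conj_mat_compose matrix_mul_assoc)
    finally show ?thesis using trace by simp
  qed
  have "\<bar>d$1\<bar> + \<bar>d$2\<bar> + \<bar>d$3\<bar> \<le> s"
    by (rule trace_rotation_bound[OF rot det_T svd(3,1,2,4,5)])
  moreover have "orthogonal_matrix X" "orthogonal_matrix Y"
    using svd by (auto simp: rotation_matrix_def)
  ultimately obtain u v where uv: "\<forall>m<7. u m \<in> forward_cone \<and> v m \<in> forward_cone"
    "block_mat s 0 T = (\<Sum>m<(7::nat). outer (u m) (v m))"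
    using block_mat_diag_decomp[OF svd(3)] by blast
  \<comment> \<open>For the two boosts L, \<open>?f L\<close> is the inverse of L, because L
    preserves the Minkowski form and is symmetric.\<close>
  let ?f = "\<lambda>L x. flip4 (L *v flip4 x)"
  have "R *v z = (\<Sum>m<7. outer (?f (conj_mat A) (u m)) (?f (conj_mat B) (v m))) *v z" for z
  proof -
    have adj: "v m \<bullet> ?f (conj_mat B) z = ?f (conj_mat B) (v m) \<bullet> z" for m
      using inner_transpose[of "flip4 (v m)" "conj_mat B" "flip4 z"] by (simp only: sym flip4_inner)
    have "conj_mat B *v ?f (conj_mat B) z = z" using inv(2)[of "flip4 z"] by simp
    then have "R *v z = R *v (conj_mat B *v ?f (conj_mat B) z)" by simp
    also have "\<dots> = ?f (conj_mat A) (conj_mat A *v (R *v (conj_mat B *v ?f (conj_mat B) z)))"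
      by (simp only: inv(1) flip4_flip4)
    also have "\<dots> = ?f (conj_mat A) ((\<Sum>m<7. outer (u m) (v m)) *v ?f (conj_mat B) z)"
      by (simp only: matrix_vector_mul_assoc eq[unfolded uv(2), symmetric] matrix_mul_assoc)
    also have "\<dots> = (\<Sum>m<7. (v m \<bullet> ?f (conj_mat B) z) *\<^sub>R ?f (conj_mat A) (u m))"
    proof -
      have lin: "linear (\<lambda>x. ?f (conj_mat A) x)"
        using linear_compose[OF linear_compose[OF linear_flip4 matrix_vector_mul_linear[of "conj_mat A"]] linear_flip4]
        by (simp add: o_def)
      show ?thesis
        by (simp only: sum_mult_vec outer_mult_vec linear_sum[OF lin] linear_scale[OF lin])
    qed
    finally show ?thesis
      by (simp only: sum_mult_vec outer_mult_vec adj)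
  qed
  then have "R = (\<Sum>m<7. outer (?f (conj_mat A) (u m)) (?f (conj_mat B) (v m)))"
    by (simp add: matrix_eq)
  moreover have "\<forall>m<7. ?f (conj_mat A) (u m) \<in> forward_cone \<and> ?f (conj_mat B) (v m) \<in> forward_cone"
    using uv(1) by (simp add: conj_mat_forward_cone)
  ultimately show ?thesis
    by (intro exI[of _ "\<lambda>m. ?f (conj_mat A) (u m)"] exI[of _ "\<lambda>m. ?f (conj_mat B) (v m)"] conjI)
qed

section \<open>From the normal form to entanglement breaking\<close>

lemma closed_forward_cone: "closed forward_cone"
  unfolding forward_cone_def
  by (intro closed_Collect_le continuous_intros linear_continuous_on
      linear_spat[unfolded linear_conv_bounded_linear])

lemma norm_forward_cone: "x \<in> forward_cone \<Longrightarrow> norm x \<le> 2 * x$1"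
proof -
  assume x: "x \<in> forward_cone"
  have "x = vec4 (x$1) 0 + vec4 0 (spat x)" by (simp add: vec_eq_iff forall_4)
  then have "norm x \<le> norm (vec4 (x$1) 0) + norm (vec4 0 (spat x))" by (metis norm_triangle_ineq)
  moreover have "norm (vec4 (x$1) 0) = \<bar>x$1\<bar>" "norm (vec4 0 (spat x)) = norm (spat x)"
    by (simp_all add: norm_eq_sqrt_inner inner_spat)
  moreover have "norm (spat x) \<le> x$1" "0 \<le> x$1" using x by (simp add: forward_cone_def) (use x in \<open>simp add: forward_cone_iff\<close>)
  ultimately show ?thesis by simp
qed

lemma compact_forward_cone_le: "compact {x \<in> forward_cone. x$1 \<le> c}"
proof -
  have "closed {x :: real^4. x$1 \<le> c}"
    by (intro closed_Collect_le continuous_intros)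
  moreover have "{x \<in> forward_cone. x$1 \<le> c} = forward_cone \<inter> {x. x$1 \<le> c}" by blast
  moreover have "bounded {x \<in> forward_cone. x$1 \<le> c}"
    by (rule boundedI[of _ "2 * c"]) (use norm_forward_cone in fastforce)
  ultimately show ?thesis
    using closed_forward_cone by (simp add: compact_eq_bounded_closed closed_Int)
qed

lemma compact_forward_cone_eq: "compact {x \<in> forward_cone. x$1 = 1}"
proof -
  have "closed {x :: real^4. x$1 = 1}"
    by (intro closed_Collect_eq continuous_intros)
  moreover have "{x \<in> forward_cone. x$1 = 1} = {x. x$1 = 1} \<inter> {x \<in> forward_cone. x$1 \<le> 1}" by auto
  ultimately show ?thesis
    using compact_forward_cone_le by (simp add: closed_Int_compact)
qed

text \<open>The normalisation of \<open>u\<close> and the bound on \<open>v\<close> confine both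
  factors to compact slices of the cone.\<close>

definition unit_terms :: "(real^4^4) set" where
  "unit_terms = (\<lambda>(u, v). outer u v) ` ({u \<in> forward_cone. u$1 = 1} \<times> {v \<in> forward_cone. v$1 \<le> 1})"

lemma compact_unit_terms: "compact unit_terms"
  unfolding unit_terms_def outer_def case_prod_beta
  by (intro compact_continuous_image compact_Times compact_forward_cone_eq compact_forward_cone_le
      continuous_on_vec_lambda continuous_intros)

lemma compact_sum_set:
  fixes K :: "'a::real_normed_vector set"
  assumes "compact K"
  shows "compact {\<Sum>m<n. M m | M. \<forall>m<(n::nat). M m \<in> K}"
proof (induction n)
  case 0
  then show ?case by simp
next
  case (Suc n)
  have "{\<Sum>m<Suc n. M m | M. \<forall>m<Suc n. M m \<in> K}
      = {x + y | x y. x \<in> {\<Sum>m<n. M m | M. \<forall>m<n. M m \<in> K} \<and> y \<in> K}" (is "?L = ?R")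
  proof
    show "?L \<subseteq> ?R" by fastforce
    show "?R \<subseteq> ?L"
    proof
      fix z assume "z \<in> ?R"
      then obtain M y where My: "\<forall>m<n. M m \<in> K" "y \<in> K" "z = (\<Sum>m<n. M m) + y" by blast
      then have "z = (\<Sum>m<Suc n. (M(n := y)) m)" "\<forall>m<Suc n. (M(n := y)) m \<in> K"
        by (simp_all add: less_Suc_eq)
      then show "z \<in> ?L" by blast
    qed
  qed
  then show ?case using compact_sums[OF Suc assms] by simp
qed

text \<open>The scale of each term moves from \<open>u\<close> to \<open>v\<close>. Trace
  preservation at the time axis makes the products of leading coordinates sum to one, and being
  nonnegative each is at most one.\<close>

lemma normalize_terms:
  assumes uv: "\<forall>m<n. u m \<in> forward_cone \<and> v m \<in> forward_cone" and R: "R = (\<Sum>m<(n::nat). outer (u m) (v m))"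
    and tp: "\<And>x. (R *v x)$1 = x$1"
  shows "R \<in> {\<Sum>m<n. M m | M. \<forall>m<n. M m \<in> unit_terms}"
proof -
  let ?e = "axis 1 1 :: real^4"
  \<comment> \<open>A cone vector with zero time coordinate vanishes, so such a term is zero and is
    represented by a zero second factor.\<close>
  let ?M = "\<lambda>m. if u m $ 1 = 0 then outer ?e 0 else outer ((1 / u m $ 1) *\<^sub>R u m) (u m $ 1 *\<^sub>R v m)"
  have M: "?M m = outer (u m) (v m)" if "m < n" for m
  proof (cases "u m $ 1 = 0")
    case True
    then have "u m = 0" using uv that norm_forward_cone[of "u m"] by simp
    then show ?thesis by (simp add: outer_def vec_eq_iff)
  next
    case False
    then show ?thesis by (simp add: outer_def vec_eq_iff)
  qed
  have nn: "0 \<le> x$1" if "x \<in> forward_cone" for x using that by (simp add: forward_cone_iff)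
  have "(\<Sum>m<n. v m $ 1 * u m $ 1) = 1"
    using tp[of ?e] by (simp add: R sum_mult_vec outer_mult_vec inner_axis sum_component)
  then have le: "u m $ 1 * v m $ 1 \<le> 1" if "m < n" for m
    using member_le_sum[of m "{..<n}" "\<lambda>m. v m $ 1 * u m $ 1"] uv nn that by (simp add: mult.commute)
  have "?M m \<in> unit_terms" if m: "m < n" for m
  proof (cases "u m $ 1 = 0")
    case True
    have "?e \<in> forward_cone" "0 \<in> forward_cone" by (simp_all add: forward_cone_def)
    then have "outer ?e 0 \<in> unit_terms"
      unfolding unit_terms_def by (intro image_eqI[of _ _ "(?e, 0)"]) simp_all
    then show ?thesis using True by simp
  next
    case False
    then have "0 < u m $ 1" using uv m nn[of "u m"] by force
    then have "(1 / u m $ 1) *\<^sub>R u m \<in> forward_cone" "u m $ 1 *\<^sub>R v m \<in> forward_cone"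
      using uv m by (simp_all add: forward_cone_def divide_right_mono)
    then have "outer ((1 / u m $ 1) *\<^sub>R u m) (u m $ 1 *\<^sub>R v m) \<in> unit_terms"
      unfolding unit_terms_def using False le[OF m]
      by (intro image_eqI[of _ _ "((1 / u m $ 1) *\<^sub>R u m, u m $ 1 *\<^sub>R v m)"]) simp_all
    then show ?thesis using False by simp
  qed
  moreover have "R = (\<Sum>m<n. ?M m)"
    unfolding R by (rule sum.cong) (simp_all only: M lessThan_iff)
  ultimately show ?thesis by blast
qed

lemma trace_outer_axis_conj_mat: "0 \<le> trace (outer (axis 1 1) (axis 1 1) ** conj_mat A)"
proof -
  let ?e = "axis 1 1 :: real^4"
  have "?e \<in> forward_cone" by (simp add: hyperboloid_forward_cone)
  then have "0 \<le> (conj_mat A *v ?e) $ 1" using conj_mat_forward_cone[of ?e A] by (simp add: forward_cone_iff)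
  then have "0 \<le> conj_mat A $ 1 $ 1" by (simp add: matrix_vector_mult_basis column_def)
  then show ?thesis
    by (simp add: trace_def sum_4 outer_def matrix_matrix_mult_def axis_def)
qed

text \<open>Mixing with the completely depolarising map \<open>outer ?e ?e\<close> gives strict
  positivity, so the previous decomposition applies. Sums of seven normalised terms form a compact
  set, hence the limit of vanishing mixing has this form too.\<close>

lemma channel_separable:
  assumes tp: "\<And>x. (R *v x)$1 = x$1" and pos: "\<And>x. x \<in> forward_cone \<Longrightarrow> R *v x \<in> forward_cone"
    and trace: "\<And>A. 0 \<le> trace (R ** conj_mat A)" and det: "det R \<le> 0"
  shows "\<exists>u v. (\<forall>m<7. u m \<in> forward_cone \<and> v m \<in> forward_cone \<and> u m $ 1 = 1) \<and> R = (\<Sum>m<(7::nat). outer (u m) (v m))"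
proof -
  let ?e = "axis 1 1 :: real^4"
  let ?S = "{\<Sum>m<7. M m | M. \<forall>m<(7::nat). M m \<in> unit_terms}"
  define P where "P \<epsilon> = (1 - \<epsilon>) *\<^sub>R R + \<epsilon> *\<^sub>R outer ?e ?e" for \<epsilon> :: real
  have P_vec: "P \<epsilon> *v x = (1 - \<epsilon>) *\<^sub>R (R *v x) + (\<epsilon> * x$1) *\<^sub>R ?e" for \<epsilon> x
    by (simp add: P_def matrix_vector_mult_add_rdistrib outer_mult_vec inner_axis inner_commute[of ?e]
        flip: scaleR_matrix_vector_assoc)
  have "P \<epsilon> \<in> ?S" if \<epsilon>: "0 < \<epsilon>" "\<epsilon> \<le> 1" for \<epsilon>
  proof -
    have tpP: "(P \<epsilon> *v x)$1 = x$1" for x by (simp add: P_vec tp algebra_simps)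
    have posP: "\<epsilon> * (x$1 * y$1) \<le> x \<bullet> (P \<epsilon> *v y)" if "x \<in> forward_cone" "y \<in> forward_cone" for x y
      using inner_forward_cone_nonneg[OF that(1) pos[OF that(2)]] \<epsilon>
      by (simp add: P_vec inner_add_right inner_axis mult_ac)
    have "trace (P \<epsilon> ** conj_mat A) = (1 - \<epsilon>) * trace (R ** conj_mat A) + \<epsilon> * trace (outer ?e ?e ** conj_mat A)" for A
      by (simp add: P_def trace_def matrix_matrix_mult_def sum_4 algebra_simps)
    then have trP: "0 \<le> trace (P \<epsilon> ** conj_mat A)" for A
      using trace[of A] trace_outer_axis_conj_mat[of A] \<epsilon> by simp
    obtain t T where RT: "R = block_mat 1 t T"
      using ex_block_mat[of R 1] tp by auto
    \<comment> \<open>Mixing scales the spatial block by 1 - \<epsilon>, so it multiplies the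
      determinant by a nonnegative factor.\<close>
    have "P \<epsilon> = block_mat 1 ((1 - \<epsilon>) *\<^sub>R t) ((1 - \<epsilon>) *\<^sub>R T)"
      by (simp add: P_def RT block_mat_def outer_def vec_eq_iff forall_4 axis_def)
    then have "det (P \<epsilon>) = (1 - \<epsilon>) ^ 3 * det T"
      by (simp add: det_block_mat det_3 power3_eq_cube algebra_simps)
    also have "\<dots> \<le> 0" using det \<epsilon> by (simp add: RT det_block_mat mult_nonneg_nonpos)
    finally obtain u v where "\<forall>m<7. u m \<in> forward_cone \<and> v m \<in> forward_cone" "P \<epsilon> = (\<Sum>m<(7::nat). outer (u m) (v m))"
      using strict_separable[OF \<epsilon>(1) posP trP] by blast
    then show ?thesis by (rule normalize_terms[OF _ _ tpP])
  qed
  then have inS: "P (inverse (real (Suc n))) \<in> ?S" for n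
    by (simp add: inverse_le_1_iff)
  have "closed ?S" using compact_sum_set[OF compact_unit_terms] by (rule compact_imp_closed)
  moreover have "(\<lambda>n. P (inverse (real (Suc n)))) \<longlonglongrightarrow> (1 - 0) *\<^sub>R R + 0 *\<^sub>R outer ?e ?e"
    unfolding P_def by (intro tendsto_intros LIMSEQ_inverse_real_of_nat)
  then have "(\<lambda>n. P (inverse (real (Suc n)))) \<longlonglongrightarrow> R" by simp
  ultimately have "R \<in> ?S"
    by (intro closed_sequentially[OF _ inS])
  then obtain M where M: "\<forall>m<7. M m \<in> unit_terms" "R = (\<Sum>m<(7::nat). M m)" by blast
  have "\<exists>u v. u \<in> forward_cone \<and> v \<in> forward_cone \<and> u $ 1 = 1 \<and> M m = outer u v" if "m < 7" for m
  proof -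
    have "M m \<in> unit_terms" using M(1) that by blast
    then show ?thesis unfolding unit_terms_def by auto
  qed
  then obtain u v where uv: "\<And>m. m < 7 \<Longrightarrow> u m \<in> forward_cone \<and> v m \<in> forward_cone \<and> u m $ 1 = 1 \<and> M m = outer (u m) (v m)"
    by metis
  then have "R = (\<Sum>m<7. outer (u m) (v m))"
    unfolding M(2) by (intro sum.cong) auto
  with uv show ?thesis by blast
qed

section \<open>Measure-and-prepare form and separable outputs\<close>

lemma psd_on_diag:
  assumes "psd_on I M" "finite I" "i \<in> I"
  shows "0 \<le> M i i"
proof -
  let ?v = "\<lambda>x. if x = i then 1 else 0 :: complex"
  have "(\<Sum>x\<in>I. \<Sum>y\<in>I. cnj (?v x) * M x y * ?v y) = M i i"
  proof -
    have "(\<Sum>x\<in>I. \<Sum>y\<in>I. cnj (?v x) * M x y * ?v y) = (\<Sum>x\<in>{i}. \<Sum>y\<in>I. cnj (?v x) * M x y * ?v y)"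
      using assms(2,3) by (intro sum.mono_neutral_right) auto
    also have "\<dots> = (\<Sum>x\<in>{i}. \<Sum>y\<in>{i}. cnj (?v x) * M x y * ?v y)"
      using assms(2,3) by (intro sum.cong sum.mono_neutral_right) auto
    finally show ?thesis by simp
  qed
  moreover have "0 \<le> (\<Sum>x\<in>I. \<Sum>y\<in>I. cnj (?v x) * M x y * ?v y)"
    by (rule assms(1)[unfolded psd_on_def, rule_format])
  ultimately show ?thesis by simp
qed

text \<open>With zero diagonal the form on two coordinates is real-linear in \<open>c\<close>; its
  nonnegativity for 1, the imaginary unit and their negatives makes the entry vanish.\<close>

lemma psd_on_zero:
  assumes M: "psd_on I M" and I: "finite I" "i \<in> I" "j \<in> I" and 0: "M i i = 0" "M j j = 0"
  shows "M i j = 0"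
proof (cases "i = j")
  case False
  have "0 \<le> c * M i j + cnj c * M j i" for c
  proof -
    let ?v = "\<lambda>x. if x = i then 1 else if x = j then c else 0"
    have "(\<Sum>x\<in>I. \<Sum>y\<in>I. cnj (?v x) * M x y * ?v y) = (\<Sum>x\<in>{i, j}. \<Sum>y\<in>I. cnj (?v x) * M x y * ?v y)"
      using I by (intro sum.mono_neutral_right) auto
    also have "\<dots> = (\<Sum>x\<in>{i, j}. \<Sum>y\<in>{i, j}. cnj (?v x) * M x y * ?v y)"
      using I by (intro sum.cong sum.mono_neutral_right) auto
    also have "\<dots> = c * M i j + cnj c * M j i"
      using False 0 by simp
    finally have "(\<Sum>x\<in>I. \<Sum>y\<in>I. cnj (?v x) * M x y * ?v y) = c * M i j + cnj c * M j i" .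
    moreover have "0 \<le> (\<Sum>x\<in>I. \<Sum>y\<in>I. cnj (?v x) * M x y * ?v y)"
      by (rule M[unfolded psd_on_def, rule_format])
    ultimately show ?thesis by simp
  qed
  from this[of 1] this[of "-1"] this[of \<i>] this[of "-\<i>"] show ?thesis
    by (auto simp: less_eq_complex_def complex_eq_iff)
qed (use 0 in simp)

lemma psd_on_trace_zero:
  assumes M: "psd_on I M" and I: "finite I" and 0: "(\<Sum>i\<in>I. M i i) = 0" and ij: "i \<in> I" "j \<in> I"
  shows "M i j = 0"
proof -
  have "\<forall>i\<in>I. M i i = 0"
    using sum_nonneg_eq_0_iff[of I "\<lambda>i. M i i"] I 0 psd_on_diag[OF M I] by blast
  then show ?thesis using psd_on_zero[OF M I] ij by blast
qed

text \<open>Compression of the second tensor factor by the vector \<open>g\<close>: its form at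
  \<open>w\<close> is the form of \<sigma> at w \<otimes> g.\<close>

lemma psd_on_partial:
  fixes \<sigma> :: bimat
  assumes "psd_on (bi_index k) \<sigma>"
  shows "psd_on {..<k} (\<lambda>a b. \<Sum>i\<in>UNIV. \<Sum>j\<in>UNIV. g j * cnj (g i) * \<sigma> (a, i) (b, j))"
  unfolding psd_on_def
proof
  fix w :: "nat \<Rightarrow> complex"
  let ?W = "\<lambda>(a, i). w a * g i"
  have "(\<Sum>a\<in>{..<k}. \<Sum>b\<in>{..<k}. cnj (w a) * (\<Sum>i\<in>UNIV. \<Sum>j\<in>UNIV. g j * cnj (g i) * \<sigma> (a, i) (b, j)) * w b)
      = (\<Sum>x\<in>bi_index k. \<Sum>y\<in>bi_index k. cnj (?W x) * \<sigma> x y * ?W y)"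
    unfolding sum.cartesian_product'
    by (simp add: sum_2 sum.distrib algebra_simps)
  then show "0 \<le> (\<Sum>a\<in>{..<k}. \<Sum>b\<in>{..<k}. cnj (w a) *
      (\<Sum>i\<in>UNIV. \<Sum>j\<in>UNIV. g j * cnj (g i) * \<sigma> (a, i) (b, j)) * w b)"
    using assms unfolding psd_on_def by simp
qed

text \<open>Each product acts as a measurement of the effect \<open>herm (v m)\<close> followed by
  preparation of half of \<open>herm (u m)\<close>; the half offsets the factor 2 in the trace
  form.\<close>

lemma map_of_mat_sum_outer:
  assumes "R = (\<Sum>m<(n::nat). outer (u m) (v m))"
  shows "blinfun_apply (map_of_mat R) X $ i $ j
    = (\<Sum>m<n. (\<Sum>k\<in>UNIV. \<Sum>l\<in>UNIV. herm (v m) $ l $ k * X $ k $ l) * herm ((1 / 2) *\<^sub>R u m) $ i $ j)"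
proof -
  have tr: "(\<Sum>k\<in>UNIV. \<Sum>l\<in>UNIV. herm w $ l $ k * X $ k $ l) = 2 * Complex (w \<bullet> pauli_re X) (w \<bullet> pauli_im X)" for w
    by (simp add: sum_2 inner_vec_def sum_4 complex_eq_iff field_simps)
  have "linear (\<lambda>R. blinfun_apply (map_of_mat R) X $ i $ j)"
    using linear_compose[OF linear_compose[OF linear_map_of_mat bounded_linear.linear[OF blinfun.bounded_linear_left]]]
    by (intro linearI) (simp_all add: linear_add[OF linear_map_of_mat] linear_scale[OF linear_map_of_mat] blinfun.add_left blinfun.scaleR_left)
  from linear_sum[OF this] have "blinfun_apply (map_of_mat R) X $ i $ j = (\<Sum>m<n. blinfun_apply (map_of_mat (outer (u m) (v m))) X $ i $ j)"
    unfolding assms .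
  moreover have "blinfun_apply (map_of_mat (outer a b)) X $ i $ j = 2 * Complex (b \<bullet> pauli_re X) (b \<bullet> pauli_im X) * herm ((1 / 2) *\<^sub>R a) $ i $ j" for a b
    by (simp add: map_of_mat_apply outer_mult_vec linear_scale[OF linear_herm] del: herm_nth)
       (simp add: complex_eq_iff algebra_simps)
  ultimately show ?thesis by (simp only: tr)
qed

text \<open>Measuring the second factor leaves the unnormalised state \<open>r m\<close> on the
  first with weight \<open>p m\<close>, and the map prepares \<open>\<tau> m\<close> beside it.
  Normalising \<open>r m\<close> gives the separable decomposition.\<close>

lemma entanglement_breaking_map_of_mat:
  assumes uv: "\<forall>m<n. u m \<in> forward_cone \<and> v m \<in> forward_cone \<and> u m $ 1 = 1"
    and R: "R = (\<Sum>m<(n::nat). outer (u m) (v m))" and tp: "trace_preserving (map_of_mat R)"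
  shows "entanglement_breaking (map_of_mat R)"
  unfolding entanglement_breaking_def
proof (intro allI impI)
  fix k :: nat and \<sigma> assume k: "0 < k" and \<sigma>: "density_on (bi_index k) \<sigma>"
  define \<tau> where "\<tau> m = herm ((1 / 2) *\<^sub>R u m)" for m
  define r where "r m a b = (\<Sum>i\<in>UNIV. \<Sum>j\<in>UNIV. herm (v m) $ j $ i * \<sigma> (a, i) (b, j))" for m a b
  define p where "p m = Re (\<Sum>a<k. r m a a)" for m
  \<comment> \<open>An outcome of weight zero still needs some density matrix; the projector onto
    the basis vector 0 serves, as \<open>k\<close> is positive.\<close>
  define \<rho> where "\<rho> m a b = (if p m = 0 then if a = 0 \<and> b = 0 then 1 else 0 else r m a b / of_real (p m))" for m a b
  have psd: "psd_on {..<k} (r m)" if m: "m < n" for m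
  proof -
    have "v m \<in> forward_cone" using uv m by blast
    then obtain g h where gh: "\<And>i j. herm (v m) $ i $ j = g i * cnj (g j) + h i * cnj (h j)"
      using herm_gram by metis
    have "r m = (\<lambda>a b. (\<Sum>i\<in>UNIV. \<Sum>j\<in>UNIV. g j * cnj (g i) * \<sigma> (a, i) (b, j))
        + (\<Sum>i\<in>UNIV. \<Sum>j\<in>UNIV. h j * cnj (h i) * \<sigma> (a, i) (b, j)))"
      unfolding r_def gh distrib_right sum.distrib ..
    then show ?thesis
      using \<sigma> by (simp only: psd_on_add psd_on_partial density_on_def)
  qed
  have p: "0 \<le> p m" "(\<Sum>a<k. r m a a) = of_real (p m)" if "m < n" for m
  proof -
    have "0 \<le> (\<Sum>a<k. r m a a)"
      using psd[OF that] by (intro sum_nonneg psd_on_diag[of "{..<k}"]) auto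
    then show "0 \<le> p m" "(\<Sum>a<k. r m a a) = of_real (p m)"
      by (simp_all add: p_def less_eq_complex_def complex_eq_iff)
  qed
  have \<rho>: "density_on {..<k} (\<rho> m)" if m: "m < n" for m
  proof (cases "p m = 0")
    case True
    have "\<rho> m = (\<lambda>a b. (if a = 0 then 1 else 0) * cnj (if b = 0 then 1 else 0))"
      using True by (auto simp: \<rho>_def fun_eq_iff)
    then have "psd_on {..<k} (\<rho> m)" by (simp only: psd_gram finite_lessThan)
    moreover have "(\<Sum>a<k. \<rho> m a a) = 1" using True k by (simp add: \<rho>_def)
    ultimately show ?thesis by (simp add: density_on_def)
  next
    case False
    have "psd_on {..<k} (\<rho> m)"
      unfolding psd_on_def
    proof
      fix w
      have "(\<Sum>i<k. \<Sum>j<k. cnj (w i) * \<rho> m i j * w j) = (\<Sum>i<k. \<Sum>j<k. cnj (w i) * r m i j * w j) / of_real (p m)"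
        using False by (simp add: \<rho>_def sum_divide_distrib)
      moreover have "0 \<le> (\<Sum>i<k. \<Sum>j<k. cnj (w i) * r m i j * w j)"
        using psd[OF m] by (simp add: psd_on_def)
      ultimately show "0 \<le> (\<Sum>i<k. \<Sum>j<k. cnj (w i) * \<rho> m i j * w j)"
        using p(1)[OF m] by (simp add: less_eq_complex_def Re_divide_of_real Im_divide_of_real)
    qed
    moreover have "(\<Sum>a<k. \<rho> m a a) = 1"
      using False p(2)[OF m] by (simp add: \<rho>_def flip: sum_divide_distrib)
    ultimately show ?thesis by (simp add: density_on_def)
  qed
  have \<tau>: "qdensity (\<tau> m)" if "m < n" for m
  proof -
    have "u m \<in> forward_cone" using uv that by blast
    then have "(1 / 2) *\<^sub>R u m \<in> forward_cone" by (simp add: forward_cone_def)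
    then have "qpsd (\<tau> m)" by (simp add: \<tau>_def qpsd_herm)
    moreover have "\<tau> m $ 1 $ 1 + \<tau> m $ 2 $ 2 = 1" using uv that by (simp add: \<tau>_def complex_eq_iff)
    ultimately show ?thesis by (simp add: qdensity_def density_on_def qpsd_def sum_2)
  qed
  have map_of_mat: "id_tensor (map_of_mat R) \<sigma> (a, i) (b, j) = (\<Sum>m<n. r m a b * \<tau> m $ i $ j)" for a b i j
    by (simp add: id_tensor_def map_of_mat_sum_outer[OF R] r_def \<tau>_def)
  have pr: "of_real (p m) * \<rho> m a b = r m a b" if "m < n" "a < k" "b < k" for m a b
  proof (cases "p m = 0")
    case True
    then show ?thesis
      using psd_on_trace_zero[OF psd[OF that(1)]] p(2)[OF that(1)] that(2,3) by (simp add: \<rho>_def)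
  qed (simp add: \<rho>_def)
  \<comment> \<open>The prepared states have trace one, so the total weight is the trace of the
    output, which trace preservation on each diagonal block equates with the trace of
    \<sigma>.\<close>
  have "complex_of_real (\<Sum>m<n. p m) = (\<Sum>m<n. \<Sum>a<k. r m a a * (\<tau> m $ 1 $ 1 + \<tau> m $ 2 $ 2))"
    using p(2) \<tau> by (simp add: qdensity_def density_on_def sum_2)
  also have "\<dots> = (\<Sum>a<k. id_tensor (map_of_mat R) \<sigma> (a, 1) (a, 1) + id_tensor (map_of_mat R) \<sigma> (a, 2) (a, 2))"
    unfolding map_of_mat by (subst sum.swap) (simp add: distrib_left sum.distrib)
  also have "\<dots> = (\<Sum>a<k. trace (blinfun_apply (map_of_mat R) (\<chi> i j. \<sigma> (a, i) (a, j))))"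
    by (simp add: id_tensor_def trace_def sum_2)
  also have "\<dots> = (\<Sum>a<k. \<sigma> (a, 1) (a, 1) + \<sigma> (a, 2) (a, 2))"
    using tp by (simp add: trace_preserving_def trace_def sum_2)
  also have "\<dots> = (\<Sum>x\<in>bi_index k. \<sigma> x x)"
    by (simp add: sum.cartesian_product' sum_2)
  also have "\<dots> = 1" using \<sigma> by (simp add: density_on_def)
  finally have "(\<Sum>m<n. p m) = 1" by (simp only: of_real_eq_1_iff)
  moreover have "id_tensor (map_of_mat R) \<sigma> x y = (\<Sum>m<n. of_real (p m) * tensor (\<rho> m) (\<tau> m) x y)"
    if xy: "x \<in> bi_index k" "y \<in> bi_index k" for x y
  proof -
    obtain a i b j where "x = (a, i)" "y = (b, j)" by fastforce
    then show ?thesis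
      using xy by (auto simp: map_of_mat tensor_def mult.assoc[symmetric] pr intro!: sum.cong)
  qed
  ultimately show "separable k (id_tensor (map_of_mat R) \<sigma>)"
    unfolding separable_def using p(1) \<rho> \<tau> by blast
qed

section \<open>Divisibility for positive determinant\<close>

definition ptp_mat :: "real^4^4 \<Rightarrow> bool" where
  "ptp_mat R \<longleftrightarrow> (\<forall>x. (R *v x)$1 = x$1) \<and> (\<forall>x\<in>forward_cone. R *v x \<in> forward_cone)"

definition small_factors :: "real^4^4 \<Rightarrow> bool" where
  "small_factors R \<longleftrightarrow> (\<forall>\<epsilon>>0. \<exists>Rs. (\<forall>S\<in>set Rs. ptp_mat S \<and> norm (S - mat 1) < \<epsilon>) \<and> R = foldr (**) Rs (mat 1))"

lemma small_factors_mult: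
  assumes "small_factors R" "small_factors S"
  shows "small_factors (R ** S)"
  unfolding small_factors_def
proof (intro allI impI)
  fix \<epsilon> :: real assume "0 < \<epsilon>"
  then obtain Rs Ss where RS: "\<forall>S\<in>set Rs. ptp_mat S \<and> norm (S - mat 1) < \<epsilon>" "R = foldr (**) Rs (mat 1)"
    "\<forall>S\<in>set Ss. ptp_mat S \<and> norm (S - mat 1) < \<epsilon>" "S = foldr (**) Ss (mat 1)"
    using assms unfolding small_factors_def by meson
  have "foldr (**) (As @ Bs) (mat 1) = foldr (**) As (mat 1) ** foldr (**) Bs (mat 1 :: real^4^4)" for As Bs
    by (induction As) (simp_all add: matrix_mul_assoc)
  then have "R ** S = foldr (**) (Rs @ Ss) (mat 1)"
    using RS by simp
  then show "\<exists>Rs. (\<forall>S\<in>set Rs. ptp_mat S \<and> norm (S - mat 1) < \<epsilon>) \<and> R ** S = foldr (**) Rs (mat 1)"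
    using RS(1,3) by (intro exI[of _ "Rs @ Ss"]) auto
qed

text \<open>\<open>G s t\<close> plays the role of \<open>(E s)\<^sup>-\<^sup>1 ** E t\<close> for a path \<open>E\<close> of invertible matrices.\<close>

lemma small_factors_transition:
  fixes G :: "real \<Rightarrow> real \<Rightarrow> real^4^4"
  assumes cont: "continuous_on ({0..1} \<times> {0..1}) (\<lambda>p. G (fst p) (snd p))"
    and refl: "\<And>s. 0 \<le> s \<Longrightarrow> s \<le> 1 \<Longrightarrow> G s s = mat 1"
    and ptp_mat: "\<And>s t. 0 \<le> s \<Longrightarrow> s \<le> t \<Longrightarrow> t \<le> 1 \<Longrightarrow> ptp_mat (G s t)"
    and comp: "\<And>s t u. 0 \<le> s \<Longrightarrow> s \<le> t \<Longrightarrow> t \<le> u \<Longrightarrow> u \<le> 1 \<Longrightarrow> G s t ** G t u = G s u"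
  shows "small_factors (G 0 1)"
  unfolding small_factors_def
proof (intro allI impI)
  fix \<epsilon> :: real assume "0 < \<epsilon>"
  have "uniformly_continuous_on ({0..1} \<times> {0..1}) (\<lambda>p. G (fst p) (snd p))"
    using cont by (rule compact_uniformly_continuous) (simp add: compact_Times)
  then obtain \<delta> where \<delta>: "0 < \<delta>"
    "\<And>p q. p \<in> {0..1} \<times> {0..1} \<Longrightarrow> q \<in> {0..1} \<times> {0..1} \<Longrightarrow> dist q p < \<delta> \<Longrightarrow>
       dist (G (fst q) (snd q)) (G (fst p) (snd p)) < \<epsilon>"
    unfolding uniformly_continuous_on_def using \<open>0 < \<epsilon>\<close> by metis
  obtain n where n: "inverse (real (Suc n)) < \<delta>" using reals_Archimedean[OF \<delta>(1)] by blast
  let ?N = "real (Suc n)"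
  let ?S = "\<lambda>i. G (real i / ?N) (real (Suc i) / ?N)"
  let ?Rs = "map ?S [0..<Suc n]"
  \<comment> \<open>The product telescopes from the right: the steps from \<open>i\<close> onwards
    compose to the transition from \<open>i / ?N\<close> to 1.\<close>
  have "foldr (**) (map ?S [i..<Suc n]) (mat 1) = G (real i / ?N) 1" if "i \<le> Suc n" for i
    using that
  proof (induction rule: inc_induct)
    case base
    then show ?case using refl[of 1] by simp
  next
    case (step i)
    have "foldr (**) (map ?S [i..<Suc n]) (mat 1) = ?S i ** foldr (**) (map ?S [Suc i..<Suc n]) (mat 1)"
      using step.hyps by (simp only: upt_conv_Cons list.map foldr.simps comp_apply)
    also have "\<dots> = G (real i / ?N) 1"
      unfolding step.IH using step.hyps by (intro comp) (auto simp: field_simps)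
    finally show ?case .
  qed
  from this[of 0] have "G 0 1 = foldr (**) ?Rs (mat 1)" by simp
  moreover have "ptp_mat (?S i) \<and> norm (?S i - mat 1) < \<epsilon>" if "i < Suc n" for i
  proof
    have i: "0 \<le> real i / ?N" "real i / ?N \<le> real (Suc i) / ?N" "real (Suc i) / ?N \<le> 1"
      using that by (auto simp: field_simps)
    then show "ptp_mat (?S i)" by (rule ptp_mat)
    have "real (Suc i) / ?N - real i / ?N = inverse ?N"
      by (simp add: field_simps)
    then have "dist (real i / ?N, real (Suc i) / ?N) (real i / ?N, real i / ?N) < \<delta>"
      using n by (simp add: dist_Pair_Pair dist_real_def)
    then show "norm (?S i - mat 1) < \<epsilon>"
      using \<delta>(2)[of "(real i / ?N, real i / ?N)" "(real i / ?N, real (Suc i) / ?N)"] i refl[of "real i / ?N"]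
      by (simp add: dist_norm)
  qed
  ultimately show "\<exists>Rs. (\<forall>S\<in>set Rs. ptp_mat S \<and> norm (S - mat 1) < \<epsilon>) \<and> G 0 1 = foldr (**) Rs (mat 1)"
    by (intro exI[of _ ?Rs]) (auto simp del: upt_Suc)
qed

text \<open>\<open>map_of_mat\<close> is a bounded linear homomorphism, so factors close to the
  identity matrix become maps close to the identity map, at the cost of its norm bound
  \<open>K\<close>.\<close>

lemma small_factors_L_P:
  assumes "small_factors R" "qubit_channel (map_of_mat R)"
  shows "map_of_mat R \<in> L_P"
proof -
  have "\<exists>Es. set Es \<subseteq> PTP \<and> (\<forall>F\<in>set Es. norm (F - id_blinfun) < \<epsilon>) \<and> map_of_mat R = foldr (o\<^sub>L) Es id_blinfun"
    if "0 < \<epsilon>" for \<epsilon>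
  proof -
    obtain K where K: "0 < K" "\<And>S. norm (map_of_mat S) \<le> norm S * K"
      using linear_map_of_mat bounded_linear.pos_bounded linear_conv_bounded_linear by blast
    obtain Rs where Rs: "\<forall>S\<in>set Rs. ptp_mat S \<and> norm (S - mat 1) < \<epsilon> / K" "R = foldr (**) Rs (mat 1)"
      using assms(1) \<open>0 < \<epsilon>\<close> K unfolding small_factors_def by (meson divide_pos_pos)
    have "norm (map_of_mat S - id_blinfun) < \<epsilon>" if "S \<in> set Rs" for S
    proof -
      have "norm (map_of_mat S - id_blinfun) \<le> norm (S - mat 1) * K"
        using K(2)[of "S - mat 1"] by (simp add: linear_diff[OF linear_map_of_mat] map_of_mat_1)
      also have "\<dots> < \<epsilon>" using Rs(1) that K(1) by (simp add: field_simps)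
      finally show ?thesis .
    qed
    moreover have "map_of_mat (foldr (**) Rs (mat 1)) = foldr (o\<^sub>L) (map map_of_mat Rs) id_blinfun"
      by (induction Rs) (simp_all add: map_of_mat_1 map_of_mat_mult)
    moreover have "set (map map_of_mat Rs) \<subseteq> PTP"
      using Rs(1) by (auto simp: ptp_mat_def intro!: PTP_map_of_mat)
    ultimately show ?thesis
      using Rs(2) by (intro exI[of _ "map map_of_mat Rs"]) auto
  qed
  then show ?thesis using assms(2) by (simp add: L_P_def)
qed

text \<open>Homogeneity reduces the cone to its slice at time one, the Bloch ball.\<close>

lemma ptp_mat_block_mat:
  assumes "\<And>z. norm z \<le> 1 \<Longrightarrow> norm (t + T *v z) \<le> 1"
  shows "ptp_mat (block_mat 1 t T)"
proof -
  have "norm (x$1 *\<^sub>R t + T *v spat x) \<le> x$1" if x: "norm (spat x) \<le> x$1" for x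
  proof (cases "x$1 = 0")
    case True
    then show ?thesis using x by simp
  next
    case False
    then have pos: "0 < x$1" using x norm_ge_zero[of "spat x"] by linarith
    have "x$1 *\<^sub>R t + T *v spat x = x$1 *\<^sub>R (t + T *v ((1 / x$1) *\<^sub>R spat x))"
      using pos by (simp add: scaleR_add_right matrix_vector_mult_scaleR)
    moreover have "norm (t + T *v ((1 / x$1) *\<^sub>R spat x)) \<le> 1"
      using assms x pos by simp
    ultimately show ?thesis using pos by simp
  qed
  then show ?thesis by (simp add: ptp_mat_def forward_cone_def block_mat_mult_vec)
qed

lemma ptp_mat_blkD:
  assumes "ptp_mat (block_mat 1 t T)" "norm z \<le> 1"
  shows "norm (t + T *v z) \<le> 1"
  using assms by (auto simp: ptp_mat_def forward_cone_def block_mat_mult_vec dest: spec[of _ "vec4 1 z"])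

section \<open>Cutting a rotation into small rotations\<close>

lemma continuous_on_block_mat:
  assumes "continuous_on S f" "continuous_on S g"
  shows "continuous_on S (\<lambda>x. block_mat 1 (f x) (g x))"
proof -
  have "linear (\<lambda>p. block_mat 0 (fst p) (snd p))"
    by (rule linearI) (simp_all add: block_mat_def vec_eq_iff forall_4)
  then have "bounded_linear (\<lambda>p. block_mat 0 (fst p) (snd p))"
    by (simp add: linear_conv_bounded_linear)
  from bounded_linear.continuous_on[OF this continuous_on_Pair[OF assms]]
  have "continuous_on S (\<lambda>x. block_mat 1 0 0 + block_mat 0 (f x) (g x))"
    by (intro continuous_intros) simp
  then show ?thesis by (simp add: block_mat_add)
qed

lemma small_factors_rotation:
  assumes "rotation_matrix Q"
  shows "small_factors (block_mat 1 0 Q)"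
proof -
  obtain a b where ab: "norm a = 1" "norm b = 1" "Q = refl_mat b ** refl_mat a"
    using rotation_eq_refl_mat[OF assms] by blast
  have "path_connected (sphere (0 :: real^3) 1)"
    by (rule path_connected_sphere) simp
  then obtain g where g: "path g" "path_image g \<subseteq> sphere 0 1" "pathstart g = b" "pathfinish g = a"
    using ab unfolding path_connected_def by (metis mem_sphere_0)
  have n: "norm (g s) = 1" if "0 \<le> s" "s \<le> 1" for s
    using subsetD[OF g(2), of "g s"] that by (auto simp: path_image_def)
  \<comment> \<open>Each reflection is its own inverse, so the middle mirrors cancel in a
    composition and equal mirrors give the identity.\<close>
  let ?G = "\<lambda>s t. block_mat 1 0 (refl_mat (g s) ** refl_mat (g t))"
  have "small_factors (?G 0 1)"
  proof (rule small_factors_transition[where G = ?G])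
    have *: "continuous_on {0..1} g" using g(1) by (simp add: path_def)
    have "continuous_on ({0..1} \<times> {0..1}) (\<lambda>p. g (fst p))" "continuous_on ({0..1} \<times> {0..1}) (\<lambda>p. g (snd p))"
      by (intro continuous_on_compose2[OF *] continuous_intros; auto)+
    then show "continuous_on ({0..1} \<times> {0..1}) (\<lambda>p. ?G (fst p) (snd p))"
      unfolding refl_mat_def matrix_matrix_mult_def
      by (intro continuous_on_block_mat continuous_on_vec_lambda continuous_intros)
    show "?G s s = mat 1" if "0 \<le> s" "s \<le> 1" for s
      using n[OF that] by (simp add: refl_mat_square) (simp add: matrix_eq block_mat_mult_vec)
    show "ptp_mat (?G s t)" if "0 \<le> s" "s \<le> t" "t \<le> 1" for s t
    proof (rule ptp_mat_block_mat)
      have "orthogonal_matrix (refl_mat (g s) ** refl_mat (g t))"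
        using n that by (intro orthogonal_matrix_mul orthogonal_refl_mat) auto
      then show "norm (0 + (refl_mat (g s) ** refl_mat (g t)) *v z) \<le> 1" if "norm z \<le> 1" for z
        using that by (simp add: norm_orthogonal_matrix)
    qed
    show "?G s t ** ?G t u = ?G s u" if "0 \<le> s" "s \<le> t" "t \<le> u" "u \<le> 1" for s t u
    proof -
      have "refl_mat (g s) ** refl_mat (g t) ** (refl_mat (g t) ** refl_mat (g u))
          = refl_mat (g s) ** (refl_mat (g t) ** refl_mat (g t)) ** refl_mat (g u)"
        by (simp only: matrix_mul_assoc)
      then show ?thesis using n[of t] that by (simp add: block_mat_mult refl_mat_square)
    qed
  qed
  then show ?thesis using g by (simp add: ab pathstart_def pathfinish_def)
qed

text \<open>Every direction not tangent at \<open>z0\<close> is, up to scaling, a chord from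
  \<open>z0\<close> to another point of the sphere. A tangent direction is a limit of such
  directions; the parallelogram law replaces the limit.\<close>

lemma quadratic_form_nonneg:
  fixes D :: "real^'n^'n" and l :: real
  defines "Q \<equiv> \<lambda>d. l * (norm d)\<^sup>2 - (norm (D *v d))\<^sup>2"
  assumes z: "norm z0 = 1" and Q: "\<And>z. norm z = 1 \<Longrightarrow> 0 \<le> Q (z - z0)"
  shows "0 \<le> Q d"
proof -
  have scale: "Q (c *\<^sub>R d) = c\<^sup>2 * Q d" for c d
    by (simp add: Q_def matrix_vector_mult_scaleR power_mult_distrib algebra_simps)
  have para: "Q (d + e) + Q (d - e) = 2 * Q d + 2 * Q e" for d e
    unfolding Q_def power2_norm_eq_inner matrix_vector_right_distrib matrix_vector_mult_diff_distrib
    by (simp add: inner_add_left inner_add_right inner_diff_left inner_diff_right inner_commute algebra_simps)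
  have nonorth: "0 \<le> Q d" if "z0 \<bullet> d \<noteq> 0" for d
  proof -
    \<comment> \<open>The parameter at which the line through \<open>z0\<close> in direction
      \<open>d\<close> meets the sphere again.\<close>
    define c where "c = - 2 * (z0 \<bullet> d) / (d \<bullet> d)"
    have d: "d \<bullet> d \<noteq> 0" using that by auto
    then have c: "c \<noteq> 0" using that by (simp add: c_def)
    have "(norm (z0 + c *\<^sub>R d))\<^sup>2 = 1 + c * (2 * (z0 \<bullet> d) + c * (d \<bullet> d))"
      using z unfolding power2_norm_eq_inner
      by (simp add: inner_add_left inner_add_right norm_eq_1 inner_commute algebra_simps)
    also have "\<dots> = 1" using d by (simp add: c_def)
    finally have "norm (z0 + c *\<^sub>R d) = 1" by (simp add: power2_eq_1_iff) (smt (verit) norm_ge_zero)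
    then have "0 \<le> c\<^sup>2 * Q d" using Q[of "z0 + c *\<^sub>R d"] by (simp add: scale)
    then show ?thesis using c by (simp add: zero_le_mult_iff)
  qed
  show ?thesis
  proof (cases "z0 \<bullet> d = 0")
    case True
    have z1: "z0 \<bullet> z0 = 1" using z by (simp add: norm_eq_1)
    have *: "0 \<le> Q d + e\<^sup>2 * Q z0" if "e > 0" for e
    proof -
      have "0 \<le> Q (d + e *\<^sub>R z0)" "0 \<le> Q (d - e *\<^sub>R z0)"
        using True z1 that by (auto intro!: nonorth simp: inner_add_right inner_diff_right)
      then show ?thesis using para[of d "e *\<^sub>R z0"] by (simp add: scale)
    qed
    show ?thesis
    proof (rule ccontr)
      assume neg: "\<not> 0 \<le> Q d"
      then have pos: "0 < Q z0" using *[of 1] by simp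
      \<comment> \<open>With this value the sum in \<open>*\<close> equals half of
        \<open>Q d\<close>, which is negative.\<close>
      define e where "e = sqrt (- Q d / (2 * Q z0))"
      have "0 < - Q d / (2 * Q z0)" using neg pos by (intro divide_pos_pos) auto
      then have "e > 0" "e\<^sup>2 = - Q d / (2 * Q z0)" by (simp_all add: e_def del: minus_divide_left)
      then show False using *[of e] neg pos by (simp add: field_simps)
    qed
  qed (rule nonorth)
qed

text \<open>At a maximiser \<open>z0\<close> over the ball the gradient is a positive multiple
  \<open>l\<close> of \<open>z0\<close>, a Lagrange multiplier. The difference of the two sides is
  then, up to a nonnegative constant, a quadratic form in z - z0, nonnegative on chords of the
  sphere and hence everywhere.\<close>

lemma S_lemma_ball:
  fixes D :: "real^'n^'n"
  assumes sym: "transpose D = D" and inj: "inj ((*v) D)"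
    and ball: "\<And>z. norm z \<le> 1 \<Longrightarrow> norm (t + D *v z) \<le> 1"
  obtains l where "0 < l" "\<And>z. (norm (t + D *v z))\<^sup>2 - 1 \<le> l * ((norm z)\<^sup>2 - 1)"
proof -
  let ?\<phi> = "\<lambda>z. (norm (t + D *v z))\<^sup>2"
  have "continuous_on (cball 0 1) ?\<phi>"
    by (intro continuous_intros)
  moreover have "cball (0 :: real^'n) 1 \<noteq> {}" by simp
  ultimately obtain z0 where z0: "norm z0 \<le> 1" and max: "\<And>z. norm z \<le> 1 \<Longrightarrow> ?\<phi> z \<le> ?\<phi> z0"
    using continuous_attains_sup[OF compact_cball[of 0 1], of ?\<phi>] by (metis mem_cball_0)
  define g where "g = D *v (t + D *v z0)"
  have adj: "(D *v x) \<bullet> y = x \<bullet> (D *v y)" for x y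
    using inner_transpose[of x D y] by (simp only: sym)
  have expand: "?\<phi> (z0 + d) = ?\<phi> z0 + 2 * (g \<bullet> d) + (norm (D *v d))\<^sup>2" for d
  proof -
    have "g \<bullet> d = (t + D *v z0) \<bullet> (D *v d)" by (simp only: g_def adj)
    then show ?thesis
      unfolding power2_norm_eq_inner matrix_vector_right_distrib
      by (simp add: inner_add_left inner_add_right inner_commute algebra_simps)
  qed
  have grad: "2 * (g \<bullet> (z - z0)) + (norm (D *v (z - z0)))\<^sup>2 \<le> 0" if "norm z \<le> 1" for z
  proof -
    have "?\<phi> z \<le> ?\<phi> z0" using max[OF that] .
    then show ?thesis using expand[of "z - z0"] by (simp del: power_mono_iff norm_le_square)
  qed
  \<comment> \<open>At a maximum with vanishing gradient the quadratic term would vanish throughout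
    the ball, collapsing it to one point against injectivity.\<close>
  have "g \<noteq> 0"
  proof
    assume "g = 0"
    have "z = z0" if "norm z \<le> 1" for z
    proof -
      have "D *v (z - z0) = 0" using grad[OF that] \<open>g = 0\<close> by simp
      then have "D *v z = D *v z0" by (simp add: matrix_vector_mult_diff_distrib)
      then show ?thesis using inj by (simp add: inj_eq)
    qed
    from this[of 0] this[of "axis undefined 1"] show False
      by (metis norm_axis_1 norm_zero order_refl zero_le_one zero_neq_one)
  qed
  define l where "l = norm g"
  have l: "0 < l" using \<open>g \<noteq> 0\<close> by (simp add: l_def)
  have "g \<bullet> ((1 / l) *\<^sub>R g) = l"
    using l by (simp add: l_def dot_square_norm power2_eq_square)
  moreover have "g \<bullet> ((1 / l) *\<^sub>R g - z0) \<le> 0"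
  proof -
    have "norm ((1 / l) *\<^sub>R g) \<le> 1" using l by (simp add: l_def)
    from grad[OF this] show ?thesis
      using zero_le_power2[of "norm (D *v ((1 / l) *\<^sub>R g - z0))"] by linarith
  qed
  ultimately have gz: "l \<le> g \<bullet> z0" by (simp add: inner_diff_right)
  \<comment> \<open>Comparing \<open>z0\<close> with the unit vector along \<open>g\<close> gave
    \<open>l \<le> g \<bullet> z0\<close>; this is the equality case of Cauchy-Schwarz, so
    \<open>g\<close> is parallel to \<open>z0\<close>.\<close>
  have "(norm (g - l *\<^sub>R z0))\<^sup>2 = l\<^sup>2 - 2 * l * (g \<bullet> z0) + l\<^sup>2 * (norm z0)\<^sup>2"
  proof -
    have "g \<bullet> g = l * l" by (simp add: l_def dot_square_norm power2_eq_square)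
    then show ?thesis
    unfolding power2_norm_eq_inner
    by (simp add: inner_diff_left inner_diff_right inner_commute power2_eq_square algebra_simps)
  qed
  also have "\<dots> \<le> l\<^sup>2 - 2 * l * l + l\<^sup>2 * 1"
    using l gz z0 by (intro add_mono diff_mono mult_left_mono) (auto simp: power_le_one)
  also have "\<dots> = 0" by (simp add: power2_eq_square)
  finally have g: "g = l *\<^sub>R z0" by simp
  then have n0: "norm z0 = 1" using l by (simp add: l_def) (metis l l_def mult_cancel_left1 norm_scaleR abs_norm_cancel less_irrefl)
  have id: "l * ((norm z)\<^sup>2 - 1) - (?\<phi> z - ?\<phi> z0) = l * (norm (z - z0))\<^sup>2 - (norm (D *v (z - z0)))\<^sup>2" for z
  proof -
    define k where "k = z0 \<bullet> (z - z0)"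
    have "(norm z)\<^sup>2 - 1 = 2 * k + (norm (z - z0))\<^sup>2"
      using n0 unfolding power2_norm_eq_inner k_def
      by (simp add: norm_eq_1 inner_diff_left inner_diff_right inner_commute)
    moreover have "?\<phi> z = ?\<phi> z0 + 2 * (l * k) + (norm (D *v (z - z0)))\<^sup>2"
      using expand[of "z - z0"] by (simp add: g k_def)
    ultimately show ?thesis by (simp only: distrib_left)
  qed
  have nonneg: "0 \<le> l * (norm d)\<^sup>2 - (norm (D *v d))\<^sup>2" for d
  proof (rule quadratic_form_nonneg[OF n0])
    fix z :: "real^'n" assume "norm z = 1"
    then have "l * ((norm z)\<^sup>2 - 1) = 0" "?\<phi> z \<le> ?\<phi> z0"
      using max[of z] by simp_all
    then show "0 \<le> l * (norm (z - z0))\<^sup>2 - (norm (D *v (z - z0)))\<^sup>2"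
      using id[of z] by linarith
  qed
  have "?\<phi> z0 \<le> 1" using ball[OF z0] by (simp add: power_le_one)
  then have "?\<phi> z - 1 \<le> l * ((norm z)\<^sup>2 - 1)" for z
    using id[of z] nonneg[of "z - z0"] by simp
  with l that show ?thesis by blast
qed

section \<open>Shrinking the ball to an ellipsoid\<close>

lemma complete_square:
  fixes s L t x :: real
  assumes "(1 - s) + L \<noteq> 0"
  shows "(1 - s) * x\<^sup>2 + L * (x - t)\<^sup>2
    = ((1 - s) + L) * (x - L * t / ((1 - s) + L))\<^sup>2 + (1 - s) * L * t\<^sup>2 / ((1 - s) + L)"
proof -
  define a where "a = (1 - s) + L"
  have s: "1 - s = a - L" by (simp add: a_def)
  show ?thesis using assms unfolding a_def[symmetric] unfolding s
    by (simp add: field_simps power2_eq_square)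
qed

lemma diag_mat_mult_vec: "diag_mat d *v z = (\<chi> i. d$i * z$i)" for d :: "real^'n"
  by (simp add: diag_mat_def matrix_vector_mult_def if_distribR vec_eq_iff if_distrib cong: if_cong)

lemma diag_mat_mult: "diag_mat d ** diag_mat e = diag_mat (\<chi> i. d$i * e$i)" for d e :: "real^'n"
  by (simp add: matrix_eq diag_mat_mult_vec mult.assoc flip: matrix_vector_mul_assoc)

lemma norm_vec_square: "(norm x)\<^sup>2 = (\<Sum>i\<in>UNIV. (x$i)\<^sup>2)" for x :: "real^'n"
  unfolding power2_norm_eq_inner by (simp add: inner_vec_def power2_eq_square)

text \<open>The sublevel sets \<open>q s x \<le> 0\<close> are ellipsoids running from the unit ball
  to its image. The multiplier from the S-lemma makes \<open>q\<close> increase with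
  \<open>s\<close>, so they are nested, and each transition, read in the coordinates of the larger
  ellipsoid, maps the unit ball into itself.\<close>

lemma small_factors_diag:
  fixes p t :: "real^3"
  assumes p: "\<And>i. 0 < p$i" and ball: "ptp_mat (block_mat 1 t (diag_mat p))"
  shows "small_factors (block_mat 1 t (diag_mat p))"
proof -
  have "inj ((*v) (diag_mat p))"
  proof (rule injI)
    fix x y assume "diag_mat p *v x = diag_mat p *v y"
    then have "p$i * x$i = p$i * y$i" for i by (simp add: diag_mat_mult_vec vec_eq_iff)
    then show "x = y" using p by (simp add: vec_eq_iff less_imp_neq[symmetric])
  qed
  moreover have "transpose (diag_mat p) = diag_mat p"
    by (simp add: transpose_def diag_mat_def vec_eq_iff)
  ultimately obtain l where l: "0 < l"
    and S: "\<And>z. (norm (t + diag_mat p *v z))\<^sup>2 - 1 \<le> l * ((norm z)\<^sup>2 - 1)"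
    using S_lemma_ball ptp_mat_blkD[OF ball] by blast
  \<comment> \<open>\<open>q1\<close> is nonpositive exactly on the image of the ball, and
    \<open>q\<close> interpolates from the ball's function to the scaled one of the image.\<close>
  define q1 where "q1 x = (\<Sum>i\<in>UNIV. (x$i - t$i)\<^sup>2 / (p$i)\<^sup>2) - 1" for x :: "real^3"
  define q where "q s x = (1 - s) * ((norm x)\<^sup>2 - 1) + s * (l * q1 x)" for s x
  have S': "(norm x)\<^sup>2 - 1 \<le> l * q1 x" for x
  proof -
    have "t + diag_mat p *v (\<chi> i. (x$i - t$i) / p$i) = x"
      using p by (simp add: diag_mat_mult_vec vec_eq_iff less_imp_neq[symmetric])
    then show ?thesis
      using S[of "\<chi> i. (x$i - t$i) / p$i"] by (simp add: q1_def norm_vec_square[of "\<chi> i. _ i"] power_divide)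
  qed
  then have q_mono: "q s x \<le> q s' x" if "s \<le> s'" for s s' x
  proof -
    have "q s' x - q s x = (s' - s) * (l * q1 x - ((norm x)\<^sup>2 - 1))"
      by (simp add: q_def algebra_simps)
    then show ?thesis using that S'[of x] by (smt (verit) mult_nonneg_nonneg)
  qed
  \<comment> \<open>Completing the square in each coordinate: \<open>c s\<close> is the centre,
    \<open>w s\<close> lists the semi-axes, \<open>a s\<close> the leading coefficients, and
    \<open>- r s\<close> the minimum of \<open>q s\<close>.\<close>
  define L where "L s i = s * l / (p$i)\<^sup>2" for s i
  define a where "a s i = (1 - s) + L s i" for s i
  define c where "c s i = L s i * t$i / a s i" for s i
  define r where "r s = (1 - s) + s * l - (\<Sum>i\<in>UNIV. (1 - s) * L s i * (t$i)\<^sup>2 / a s i)" for s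
  define w where "w s i = sqrt (r s / a s i)" for s i
  have a: "0 < a s i" if "0 \<le> s" "s \<le> 1" for s i
  proof (cases "s = 0")
    case False
    then have "0 < s" using that by simp
    then have "0 < L s i" using l p[of i] by (simp add: L_def)
    then show ?thesis using that by (simp add: a_def)
  qed (simp add: a_def L_def)
  have q_eq: "q s x = (\<Sum>i\<in>UNIV. a s i * (x$i - c s i)\<^sup>2) - r s" if s: "0 \<le> s" "s \<le> 1" for s x
  proof -
    have "q s x = (\<Sum>i\<in>UNIV. (1 - s) * (x$i)\<^sup>2 + L s i * (x$i - t$i)\<^sup>2) - ((1 - s) + s * l)"
      by (simp add: q_def q1_def L_def norm_vec_square sum.distrib sum_subtractf sum_distrib_left algebra_simps)
    also have "(\<Sum>i\<in>UNIV. (1 - s) * (x$i)\<^sup>2 + L s i * (x$i - t$i)\<^sup>2)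
        = (\<Sum>i\<in>UNIV. a s i * (x$i - c s i)\<^sup>2 + (1 - s) * L s i * (t$i)\<^sup>2 / a s i)"
      unfolding a_def c_def
      by (intro sum.cong complete_square refl) (use a[OF s] in \<open>simp add: a_def less_imp_neq[symmetric]\<close>)
    finally show ?thesis by (simp add: r_def sum.distrib)
  qed
  have r: "0 < r s" if s: "0 \<le> s" "s \<le> 1" for s
  proof (cases "s = 0")
    case False
    \<comment> \<open>The final centre \<open>t\<close> is a point where \<open>q s\<close> is
      negative, so its minimum is negative and the ellipsoid nondegenerate.\<close>
    have "norm t \<le> 1" using ptp_mat_blkD[OF ball, of 0] by simp
    then have "(1 - s) * ((norm t)\<^sup>2 - 1) \<le> 0" using s by (simp add: mult_nonneg_nonpos power_le_one)
    moreover have "0 < s * l" using s l False by simp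
    ultimately have "q s t < 0" by (simp add: q_def q1_def)
    moreover have "0 \<le> (\<Sum>i\<in>UNIV. a s i * (t$i - c s i)\<^sup>2)"
      using a[OF s] by (intro sum_nonneg) (simp add: less_imp_le)
    ultimately show ?thesis using q_eq[OF s, of t] by simp
  qed (simp add: r_def L_def)
  have w: "0 < w s i" "a s i * (w s i)\<^sup>2 = r s" if "0 \<le> s" "s \<le> 1" for s i
    using a[OF that, of i] r[OF that] by (simp_all add: w_def)
  have q_sphere: "q s (\<chi> i. c s i + w s i * z$i) = r s * ((norm z)\<^sup>2 - 1)" if s: "0 \<le> s" "s \<le> 1" for s z
  proof -
    have "q s (\<chi> i. c s i + w s i * z$i) = (\<Sum>i\<in>UNIV. (a s i * (w s i)\<^sup>2) * (z$i)\<^sup>2) - r s"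
      by (simp add: q_eq[OF s] power_mult_distrib mult.assoc)
    also have "\<dots> = r s * (\<Sum>i\<in>UNIV. (z$i)\<^sup>2) - r s"
      by (simp add: w(2)[OF s] sum_distrib_left)
    finally show ?thesis by (simp add: norm_vec_square algebra_simps)
  qed
  \<comment> \<open>Parametrising the ellipsoid at \<open>s\<close> by z |-> c s + w s z,
    coordinatewise, this is the inverse of the parametrisation at \<open>s\<close> composed with the
    one at \<open>s'\<close>.\<close>
  let ?G = "\<lambda>s s'. block_mat 1 (\<chi> i. (c s' i - c s i) / w s i) (diag_mat (\<chi> i. w s' i / w s i))"
  have "small_factors (?G 0 1)"
  proof (rule small_factors_transition[where G = ?G])
    show "?G s s = mat 1" if "0 \<le> s" "s \<le> 1" for s
    proof -
      have "diag_mat (\<chi> i. w s i / w s i) = mat 1"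
        using w(1)[OF that] by (simp add: diag_mat_def mat_def vec_eq_iff less_imp_neq[symmetric])
      moreover have "(\<chi> i. (c s i - c s i) / w s i) = 0" by (simp add: vec_eq_iff)
      ultimately show ?thesis by (simp add: matrix_eq block_mat_mult_vec)
    qed
    show "?G s t ** ?G t u = ?G s u" if st: "0 \<le> s" "s \<le> t" "t \<le> u" "u \<le> 1" for s t u
    proof -
      have "w s i \<noteq> 0" "w t i \<noteq> 0" for i
        using w(1)[of s i] w(1)[of t i] st by auto
      then have "(\<chi> i. (c t i - c s i) / w s i) + diag_mat (\<chi> i. w t i / w s i) *v (\<chi> i. (c u i - c t i) / w t i)
          = (\<chi> i. (c u i - c s i) / w s i)"
        and "diag_mat (\<chi> i. w t i / w s i) ** diag_mat (\<chi> i. w u i / w t i) = diag_mat (\<chi> i. w u i / w s i)"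
        by (simp_all add: diag_mat_mult diag_mat_mult_vec vec_eq_iff flip: add_divide_distrib)
      then show ?thesis
        by (simp add: block_mat_mult)
    qed
    show "ptp_mat (?G s s')" if st: "0 \<le> s" "s \<le> s'" "s' \<le> 1" for s s'
    proof (rule ptp_mat_block_mat)
      fix z :: "real^3" assume z: "norm z \<le> 1"
      let ?y = "(\<chi> i. (c s' i - c s i) / w s i) + diag_mat (\<chi> i. w s' i / w s i) *v z"
      have "w s i \<noteq> 0" for i using w(1)[of s i] st by auto
      then have eq: "(\<chi> i. c s i + w s i * ?y $ i) = (\<chi> i. c s' i + w s' i * z$i)"
        by (simp add: diag_mat_mult_vec vec_eq_iff distrib_left)
      \<comment> \<open>\<open>?y\<close> gives, in the coordinates at \<open>s\<close>, the point
        with coordinates \<open>z\<close> at \<open>s'\<close>; monotonicity of \<open>q\<close>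
        compares its values in the two ellipsoids.\<close>
      have "r s * ((norm ?y)\<^sup>2 - 1) = q s (\<chi> i. c s' i + w s' i * z$i)"
        using q_sphere[of s ?y] st unfolding eq by simp
      also have "\<dots> \<le> q s' (\<chi> i. c s' i + w s' i * z$i)" using st(2) by (rule q_mono)
      also have "\<dots> = r s' * ((norm z)\<^sup>2 - 1)" using st by (intro q_sphere) auto
      also have "\<dots> \<le> 0" using r[of s'] st z by (simp add: mult_le_0_iff power_le_one)
      finally have "(norm ?y)\<^sup>2 \<le> 1" using r[of s] st by (simp add: mult_le_0_iff)
      then show "norm ?y \<le> 1" using power2_le_imp_le[of "norm ?y" 1] by simp
    qed
    have cont: "continuous_on {0..1} (\<lambda>s. c s i)" "continuous_on {0..1} (\<lambda>s. w s i)" for i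
    proof -
      have L: "continuous_on {0..1} (\<lambda>s. L s i)" for i
        unfolding L_def using p[of i] by (intro continuous_intros) simp
      have ca: "continuous_on {0..1} (\<lambda>s. a s i)" for i
        unfolding a_def by (intro continuous_intros L)
      have a0: "a s i \<noteq> 0" if "s \<in> {0..1}" for s i using a[of s i] that by simp
      show "continuous_on {0..1} (\<lambda>s. c s i)"
        unfolding c_def using a0 by (intro continuous_intros L ca) auto
      have "continuous_on {0..1} r"
        unfolding r_def using a0 by (intro continuous_intros L ca) auto
      then show "continuous_on {0..1} (\<lambda>s. w s i)"
        unfolding w_def using a0 by (intro continuous_intros ca) auto
    qed
    have cont2: "continuous_on ({0..1} \<times> {0..1}) (\<lambda>p. c (fst p) i)" "continuous_on ({0..1} \<times> {0..1}) (\<lambda>p. c (snd p) i)"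
      "continuous_on ({0..1} \<times> {0..1}) (\<lambda>p. w (fst p) i)" "continuous_on ({0..1} \<times> {0..1}) (\<lambda>p. w (snd p) i)" for i
      by (rule continuous_on_compose2[OF cont(1)] continuous_on_compose2[OF cont(2)], intro continuous_intros, force)+
    have w0: "w (fst x) i \<noteq> 0" if "x \<in> {0..1} \<times> {0..1::real}" for x :: "real \<times> real" and i
      using w(1)[of "fst x" i] that by auto
    have "continuous_on ({0..1} \<times> {0..1}) (\<lambda>p. if i = j then w (snd p) i / w (fst p) i else 0)" for i j
      using w0 by (cases "i = j") (auto intro!: continuous_intros cont2)
    then show "continuous_on ({0..1} \<times> {0..1}) (\<lambda>p. ?G (fst p) (snd p))"
      unfolding diag_mat_def vec_lambda_beta using w0
      by (intro continuous_on_block_mat continuous_on_vec_lambda) (auto intro!: continuous_intros cont2)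
  qed
  also have "?G 0 1 = block_mat 1 t (diag_mat p)"
  proof -
    \<comment> \<open>At \<open>s = 0\<close> the parametrisation is the identity, and at
      \<open>s = 1\<close> it is the given affine map.\<close>
    have "c 0 i = 0" "w 0 i = 1" "c 1 i = t$i" "w 1 i = p$i" for i
      using p[of i] l by (simp_all add: c_def w_def L_def a_def r_def)
    then show ?thesis by simp
  qed
  finally show ?thesis .
qed

text \<open>A positive determinant together with the ordering of the singular values makes all three
  positive. Splitting off the two rotations leaves a diagonal affine map, which still preserves the
  ball because rotations do.\<close>

lemma small_factors_det_pos:
  assumes "ptp_mat R" "0 < det R"
  shows "small_factors R"
proof -
  obtain t T where R: "R = block_mat 1 t T"
    using ex_block_mat[of R 1] assms(1) by (auto simp: ptp_mat_def)
  obtain X Y d where svd: "rotation_matrix X" "rotation_matrix Y" "T = X ** diag_mat d ** transpose Y"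
    "d$2 \<le> d$1" "\<bar>d$3\<bar> \<le> d$2"
    by (rule svd3)
  have orth: "orthogonal_matrix X" "orthogonal_matrix Y" and det1: "det X = 1" "det Y = 1"
    using svd by (auto simp: rotation_matrix_def)
  have "0 < d$1 * d$2 * d$3"
    using assms(2) by (simp add: R det_block_mat svd(3) det_mul det1 det_diag3)
  then have "d$1 \<noteq> 0" "d$2 \<noteq> 0" "d$3 \<noteq> 0" by auto
  then have d12: "0 < d$1" "0 < d$2" using svd(4,5) by auto
  with \<open>0 < d$1 * d$2 * d$3\<close> have "0 < d$3"
    by (metis mult_pos_pos zero_less_mult_pos)
  with d12 have d: "0 < d$i" for i using exhaust_3[of i] by auto
  have "R = block_mat 1 0 X ** block_mat 1 (transpose X *v t) (diag_mat d) ** block_mat 1 0 (transpose Y)"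
    using orth by (simp add: R block_mat_mult svd(3) matrix_vector_mul_assoc orthogonal_matrix_def del: transpose_matrix_vector)
  moreover have "ptp_mat (block_mat 1 (transpose X *v t) (diag_mat d))"
  proof (rule ptp_mat_block_mat)
    fix z :: "real^3" assume z: "norm z \<le> 1"
    have "norm (transpose X *v t + diag_mat d *v z) = norm (X *v (transpose X *v t + diag_mat d *v z))"
      by (simp only: norm_orthogonal_matrix[OF orth(1)])
    also have "X *v (transpose X *v t + diag_mat d *v z) = t + T *v (Y *v z)"
    proof -
      have "X *v (transpose X *v t + diag_mat d *v z) = (X ** transpose X) *v t + (X ** diag_mat d ** (transpose Y ** Y)) *v z"
        using orth(2) unfolding orthogonal_matrix
        by (simp add: matrix_vector_right_distrib matrix_vector_mul_assoc del: transpose_matrix_vector)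
      then show ?thesis
        using orth(1) by (simp add: svd(3) orthogonal_matrix_def matrix_vector_mul_assoc matrix_mul_assoc)
    qed
    also have "norm \<dots> \<le> 1"
      using assms(1) z by (intro ptp_mat_blkD) (simp_all add: R norm_orthogonal_matrix orth)
    finally show "norm (transpose X *v t + diag_mat d *v z) \<le> 1" .
  qed
  moreover have "rotation_matrix (transpose Y)"
    using svd(2) by (simp add: rotation_matrix_def orthogonal_matrix_transpose)
  ultimately show ?thesis
    using svd(1) d by (simp add: small_factors_mult small_factors_rotation small_factors_diag)
qed

theorem theorem20:
  fixes E :: qmap
  assumes "qubit_channel E"
  shows "(det (pauli_rep E) < 0 \<longrightarrow> entanglement_breaking E) \<and>
         (\<not> infinitesimal_divisible_PTP E \<longrightarrow> entanglement_breaking E)"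
proof -
  obtain R where R: "E = map_of_mat R" "\<And>x. (R *v x)$1 = x$1" "\<And>x. x \<in> forward_cone \<Longrightarrow> R *v x \<in> forward_cone"
    "\<And>A. 0 \<le> trace (R ** conj_mat A)"
    using qubit_channel_map_of_mat[OF assms] by blast
  have EB: "entanglement_breaking E" if "det R \<le> 0"
    using channel_separable[OF R(2-4) that] entanglement_breaking_map_of_mat[of 7 _ _ R] assms
    by (auto simp: R(1) qubit_channel_def)
  \<comment> \<open>A positive determinant puts \<open>E\<close> into \<open>L_P\<close> itself, so
    failure of divisibility forces a nonpositive determinant, which \<open>EB\<close>
    covers.\<close>
  have "E \<in> L_P" if "0 < det R"
    using small_factors_L_P[OF small_factors_det_pos] that R assms by (simp add: ptp_mat_def)
  then have "infinitesimal_divisible_PTP E" if "0 < det R"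
    using that assms closure_subset[of L_P] by (auto simp: infinitesimal_divisible_PTP_def)
  then show ?thesis
    using EB det_pauli_rep[of R] by (cases "det R \<le> 0") (auto simp: R(1) less_complex_def)
qed

end
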